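(* Let $\mathfrak g\subset\mathbb C^{c\times c}$ be a matrix Lie algebra (a real linear subspace closed under commutators), let $\mathcal G$ be a gauge proto-Lagrangian and consider the Lagrangian density $\mathcal G_A$ for free gauge fields $A_\mu\in C^\infty(\mathbb R^N;\mathfrak g)$, $1\le\mu\le N$. A. The Euler–Lagrange equations for the free gauge fields $A_\mu$, $1\le\mu\le N$, with values in $\mathfrak g$ read $$\sum_{\mu=1}^N\Pi\Big(\Big(\nabla^A_\mu\big([\Pi\hat{\mathcal G}^{(\mu\kappa\star)}_A]^\dagger\big)\Big)^\dagger\Big)=0,\qquad1\le\kappa\le N .$$ B. In the special case $\mathfrak g^\dagger=\mathfrak g$ the Euler–Lagrange equations simplify to $$\sum_{\mu=1}^N\nabla^A_\mu\,\Pi\hat{\mathcal G}^{(\mu\kappa)}_A=0,\qquad1\le\kappa\le N .$$ C. If $\mathfrak g=\mathfrak g_J=\{X\in\mathbb C^{c\times c}:X^\dagger J+JX=0\}$ with $J=J^\dagger=J^{-1}$, the latter becomes $$\sum_{\mu=1}^N\nabla^A_\mu\Big(\mathcal Q_J\big[\hat{\mathcal G}^{(\mu\kappa)}_A\big]\Big)=0,\qquad1\le\kappa\le N,$$ where $\mathcal Q_JZ=\tfrac12Z-\tfrac12JZ^\dagger J$ for $Z\in\mathbb C^{c\times c}$.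
   Context: Fix positive integers $N,c$; $^\dagger$ is the conjugate transpose; $[X,Y]=XY-YX$ for a pair of matrices. $\Pi:\mathbb C^{c\times c}\to\mathfrak g$ is the orthogonal projection on $\mathfrak g$ for the real inner product $(X,Y)\mapsto\mathrm{Re}\,\mathrm{Tr}[X^\dagger Y]$. For $V\in C^\infty(\mathbb R^N;\mathbb C^{c\times c})$, $\nabla^A_\mu V=\partial_\mu V-[A_\mu,V]$. For a function $F$ of a matrix $Z\in\mathbb C^{p\times q}$, $\partial F/\partial Z$ is the $q\times p$ matrix with $(i,j)$ entry $\partial F/\partial Z_{ji}$. Gauge proto-Lagrangian: a function $\mathcal G(\dots,P_{\mu\nu},\dots;\dots,Q_{\theta\rho\star},\dots;x)\in\mathbb C$ of matrices $P_{\mu\nu}\in\mathbb C^{c\times c}$ ($1\le\mu<\nu\le N$), $Q_{\theta\rho\star}\in\mathbb C^{c\times c}$ ($1\le\theta<\rho\le N$) and $x\in\mathbb R^N$, complex analytic in the matrices and smooth in $x$, with partial derivatives $\mathcal G^{(\mu\nu)}=\partial\mathcal G/\partial P_{\mu\nu}$, $\mathcal G^{(\theta\rho\star)}=\partial\mathcal G/\partial Q_{\theta\rho\star}$, such that $\mathcal G(\dots,P_{\mu\nu},\dots;\dots,P_{\theta\rho}^\dagger,\dots;x)\in\mathbb R$ for all $x$ whenever all $P_{\mu\nu}\in\mathfrak g$. Put $F_{\mu\nu}=\partial_\mu A_\nu-\partial_\nu A_\mu-[A_\mu,A_\nu]$ and $\mathcal G_A(x)=\mathcal G(\dots,F_{\mu\nu}(x),\dots;\dots,F_{\theta\rho}^\dagger(x),\dots;x)$;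 $\mathcal G^{(\mu\nu)}_A$, $\mathcal G^{(\theta\rho\star)}_A$ denote the derivatives with the same substitution. Define $\hat{\mathcal G}^{(\mu\nu)}_A=\mathcal G^{(\mu\nu)}_A$ if $\mu<\nu$, $0$ if $\mu=\nu$, and $-\mathcal G^{(\nu\mu)}_A$ if $\mu>\nu$; $\hat{\mathcal G}^{(\mu\nu\star)}_A$ is defined from $\mathcal G^{(\mu\nu\star)}_A$ in the same antisymmetric way. Euler–Lagrange equations: the conditions on $(A_1,\dots,A_N)$ equivalent to stationarity of $\int\mathcal G_A\,dx$, i.e. for each $\kappa$ and each $H\in C_c^\infty(\mathbb R^N;\mathfrak g)$, the derivative at $\varepsilon=0$ ($\varepsilon\in\mathbb R$) of $\int_{\mathbb R^N}(\mathcal G_{A^\varepsilon}-\mathcal G_A)\,dx$ vanishes, where $A^\varepsilon$ is obtained from $A$ by replacing $A_\kappa$ with $A_\kappa+\varepsilon H$.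
   Formalization: Added: G(Q;P†;x) is the conjugate of G(P;Q†;x) for all families P,Q in g, not just reality of G(P;P†;x) on g. Without it the claim fails: N=2, c=1, g=iR, G=P_12² makes A read 0=0, and G=P_12²−Q_12² breaks B and C. *)

theory Defs
  imports "HOL-Analysis.Analysis"
begin

section \<open>Smooth functions\<close>

text \<open>On finite-dimensional spaces the following is the usual notion of a function of class
  \<open>C\<^sup>k\<close>: continuous directional derivatives up to order \<open>k\<close>.\<close>

fun times_differentiable ::
  "('a::real_normed_vector \<Rightarrow> 'b::real_normed_vector) \<Rightarrow> nat \<Rightarrow> bool" where
  "times_differentiable f 0 \<longleftrightarrow> continuous_on UNIV f"
| "times_differentiable f (Suc k) \<longleftrightarrow>
     (\<forall>x. f differentiable (at x)) \<and>
     (\<forall>v. times_differentiable (\<lambda>x. frechet_derivative f (at x) v) k)"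

definition smooth :: "('a::real_normed_vector \<Rightarrow> 'b::real_normed_vector) \<Rightarrow> bool" where
  "smooth f \<longleftrightarrow> (\<forall>k. times_differentiable f k)"

definition partial :: "'n::finite \<Rightarrow> (real^'n \<Rightarrow> 'b::real_normed_vector) \<Rightarrow> real^'n \<Rightarrow> 'b" where
  "partial \<mu> V x = frechet_derivative V (at x) (axis \<mu> 1)"

section \<open>Matrices\<close>

definition madj :: "complex^'q^'p \<Rightarrow> complex^'p^'q" where
  "madj X = (\<chi> i j. cnj (X $ j $ i))"

definition comm :: "complex^'c^'c \<Rightarrow> complex^'c^'c \<Rightarrow> complex^'c^'c" where
  "comm X Y = X ** Y - Y ** X"

definition matrix_lie_algebra :: "(complex^'c^'c) set \<Rightarrow> bool" where
  "matrix_lie_algebra \<gg> \<longleftrightarrow> subspace \<gg> \<and> (\<forall>X\<in>\<gg>. \<forall>Y\<in>\<gg>. comm X Y \<in> \<gg>)"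

definition mat_inner :: "complex^'c^'c \<Rightarrow> complex^'c^'c \<Rightarrow> real" where
  "mat_inner X Y = Re (trace (madj X ** Y))"

text \<open>The orthogonal projection on a real linear subspace \<open>\<gg>\<close>.\<close>

definition proj :: "(complex^'c^'c) set \<Rightarrow> complex^'c^'c \<Rightarrow> complex^'c^'c" where
  "proj \<gg> Z = (THE Y. Y \<in> \<gg> \<and> (\<forall>X\<in>\<gg>. mat_inner X (Z - Y) = 0))"

definition lie_J :: "complex^'c^'c \<Rightarrow> (complex^'c^'c) set" where
  "lie_J J = {X. madj X ** J + J ** X = 0}"

definition Q_J :: "complex^'c^'c \<Rightarrow> complex^'c^'c \<Rightarrow> complex^'c^'c" where
  "Q_J J Z = (1/2) *\<^sub>R Z - (1/2) *\<^sub>R (J ** madj Z ** J)"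

text \<open>Note the transposition of the indices: \<open>dF = Tr (mat_deriv F Z ** dZ)\<close>.\<close>

definition mat_deriv :: "(complex^'q^'p \<Rightarrow> complex) \<Rightarrow> complex^'q^'p \<Rightarrow> complex^'p^'q" where
  "mat_deriv F Z =
     (\<chi> i j. deriv (\<lambda>z. F (\<chi> k l. if k = j \<and> l = i then z else Z $ k $ l)) (Z $ j $ i))"

section \<open>Families of matrices\<close>

text \<open>A family \<open>(P\<^bsub>\<mu>\<nu>\<^esub>)\<close> of matrices is stored as an element \<open>P\<close> of
  \<open>complex^'c^'c^'n^'n\<close>, with \<open>P\<^bsub>\<mu>\<nu>\<^esub> = P $ \<mu> $ \<nu>\<close>. Only the members with \<open>\<mu> < \<nu>\<close> are
  meant to be arguments of a proto-Lagrangian; this is enforced by requiring that it does not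
  depend on the other ones. The index set \<open>{1, ..., N}\<close> is a finite linearly ordered type \<open>'n\<close>.\<close>

definition fam_madj :: "complex^'c^'c^'n^'n \<Rightarrow> complex^'c^'c^'n^'n" where
  "fam_madj P = (\<chi> \<mu> \<nu>. madj (P $ \<mu> $ \<nu>))"

definition fam_scale :: "complex \<Rightarrow> complex^'c^'c^'n^'n \<Rightarrow> complex^'c^'c^'n^'n" where
  "fam_scale z P = (\<chi> \<mu> \<nu> i j. z * P $ \<mu> $ \<nu> $ i $ j)"

definition fam_upd ::
  "complex^'c^'c^'n^'n \<Rightarrow> 'n \<Rightarrow> 'n \<Rightarrow> complex^'c^'c \<Rightarrow> complex^'c^'c^'n^'n" where
  "fam_upd P \<mu> \<nu> Z = (\<chi> \<mu>' \<nu>'. if \<mu>' = \<mu> \<and> \<nu>' = \<nu> then Z else P $ \<mu>' $ \<nu>')"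

definition fam_in :: "(complex^'c^'c) set \<Rightarrow> complex^'c^'c^('n::{finite,linorder})^('n::{finite,linorder}) \<Rightarrow> bool" where
  "fam_in \<gg> P \<longleftrightarrow> (\<forall>\<mu> \<nu>. \<mu> < \<nu> \<longrightarrow> P $ \<mu> $ \<nu> \<in> \<gg>)"

section \<open>Gauge proto-Lagrangians\<close>

type_synonym ('c, 'n) proto =
  "complex^'c^'c^'n^'n \<Rightarrow> complex^'c^'c^'n^'n \<Rightarrow> real^'n \<Rightarrow> complex"

text \<open>Complex analyticity of a function of several complex variables is (as in the definition of
  \<^const>\<open>holomorphic_on\<close> for one variable) complex differentiability at every point:
  a Frechet derivative exists and is complex linear.\<close>

definition analytic_in_matrices :: "('c::finite, 'n::finite) proto \<Rightarrow> bool" where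
  "analytic_in_matrices \<G> \<longleftrightarrow>
     (\<forall>x P Q. \<exists>D. ((\<lambda>(P, Q). \<G> P Q x) has_derivative D) (at (P, Q)) \<and>
        (\<forall>z H K. D (fam_scale z H, fam_scale z K) = z * D (H, K)))"

definition gauge_proto_lagrangian ::
  "(complex^'c^'c) set \<Rightarrow> ('c::finite, 'n::{finite,linorder}) proto \<Rightarrow> bool" where
  "gauge_proto_lagrangian \<gg> \<G> \<longleftrightarrow>
     (\<forall>P P' Q Q' x.
        (\<forall>\<mu> \<nu>. \<mu> < \<nu> \<longrightarrow> P $ \<mu> $ \<nu> = P' $ \<mu> $ \<nu> \<and> Q $ \<mu> $ \<nu> = Q' $ \<mu> $ \<nu>)
          \<longrightarrow> \<G> P Q x = \<G> P' Q' x) \<and>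
     analytic_in_matrices \<G> \<and>
     smooth (\<lambda>(P, Q, x). \<G> P Q x) \<and>
     (\<forall>P x. fam_in \<gg> P \<longrightarrow> \<G> P (fam_madj P) x \<in> \<real>)"

text \<open>The polarized form of the reality condition; the case \<open>P = Q\<close> is the reality condition
  itself. If \<open>\<G> P (fam_madj P) x\<close> is real for arbitrary matrices \<open>P\<close>, and not only for those in
  \<open>\<gg>\<close>, then the polarized form follows by analytic continuation. On a proper subspace \<open>\<gg>\<close> it is
  not a consequence of the reality condition, and the Euler-Lagrange equations in terms of only
  one of the two kinds of derivatives fail without it. Example: \<open>N = 2\<close>, \<open>c = 1\<close>,
  \<open>\<gg> = \<i>\<real>\<close> and \<open>\<G> P Q x = P\<^sub>1\<^sub>2\<^sup>2\<close>, which is real on \<open>\<gg>\<close> and whose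
  Euler-Lagrange equations say that \<open>F\<^sub>1\<^sub>2\<close> is constant, although \<open>\<partial>\<G>/\<partial>Q\<^sub>1\<^sub>2 = 0\<close>.
  Likewise \<open>P\<^sub>1\<^sub>2\<^sup>2 - Q\<^sub>1\<^sub>2\<^sup>2\<close> vanishes whenever \<open>P\<^sub>1\<^sub>2 \<in> \<gg>\<close> and \<open>Q\<^sub>1\<^sub>2\<close> is its adjoint,
  although \<open>\<partial>\<G>/\<partial>P\<^sub>1\<^sub>2 = 2 P\<^sub>1\<^sub>2\<close>.\<close>

definition polarized_reality ::
  "(complex^'c^'c) set \<Rightarrow> ('c::finite, 'n::{finite,linorder}) proto \<Rightarrow> bool" where
  "polarized_reality \<gg> \<G> \<longleftrightarrow>
     (\<forall>P Q x. fam_in \<gg> P \<longrightarrow> fam_in \<gg> Q \<longrightarrow>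
        \<G> Q (fam_madj P) x = cnj (\<G> P (fam_madj Q) x))"

section \<open>Gauge fields\<close>

type_synonym ('c, 'n) gauge_field = "'n \<Rightarrow> real^'n \<Rightarrow> complex^'c^'c"

definition is_gauge_field ::
  "(complex^'c^'c) set \<Rightarrow> ('c::finite, 'n::finite) gauge_field \<Rightarrow> bool" where
  "is_gauge_field \<gg> A \<longleftrightarrow> (\<forall>\<mu>. smooth (A \<mu>) \<and> range (A \<mu>) \<subseteq> \<gg>)"

definition cov_deriv ::
  "('c::finite, 'n::finite) gauge_field \<Rightarrow> 'n \<Rightarrow> (real^'n \<Rightarrow> complex^'c^'c)
     \<Rightarrow> real^'n \<Rightarrow> complex^'c^'c" where
  "cov_deriv A \<mu> V x = partial \<mu> V x - comm (A \<mu> x) (V x)"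

definition field_strength ::
  "('c::finite, 'n::finite) gauge_field \<Rightarrow> real^'n \<Rightarrow> complex^'c^'c^'n^'n" where
  "field_strength A x =
     (\<chi> \<mu> \<nu>. partial \<mu> (A \<nu>) x - partial \<nu> (A \<mu>) x - comm (A \<mu> x) (A \<nu> x))"

definition lagrangian ::
  "('c::finite, 'n::finite) proto \<Rightarrow> ('c, 'n) gauge_field \<Rightarrow> real^'n \<Rightarrow> complex" where
  "lagrangian \<G> A x = \<G> (field_strength A x) (fam_madj (field_strength A x)) x"

definition deriv_P ::
  "('c::finite, 'n::finite) proto \<Rightarrow> ('c, 'n) gauge_field \<Rightarrow> 'n \<Rightarrow> 'n
     \<Rightarrow> real^'n \<Rightarrow> complex^'c^'c" where
  "deriv_P \<G> A \<mu> \<nu> x =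
     (let P = field_strength A x; Q = fam_madj P
      in mat_deriv (\<lambda>Z. \<G> (fam_upd P \<mu> \<nu> Z) Q x) (P $ \<mu> $ \<nu>))"

definition deriv_Q ::
  "('c::finite, 'n::finite) proto \<Rightarrow> ('c, 'n) gauge_field \<Rightarrow> 'n \<Rightarrow> 'n
     \<Rightarrow> real^'n \<Rightarrow> complex^'c^'c" where
  "deriv_Q \<G> A \<mu> \<nu> x =
     (let P = field_strength A x; Q = fam_madj P
      in mat_deriv (\<lambda>Z. \<G> P (fam_upd Q \<mu> \<nu> Z) x) (Q $ \<mu> $ \<nu>))"

definition antisym_ext ::
  "('n::linorder \<Rightarrow> 'n \<Rightarrow> 'b \<Rightarrow> complex^'c^'c) \<Rightarrow> 'n \<Rightarrow> 'n \<Rightarrow> 'b \<Rightarrow> complex^'c^'c" where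
  "antisym_ext B \<mu> \<nu> x =
     (if \<mu> < \<nu> then B \<mu> \<nu> x else if \<mu> = \<nu> then 0 else - B \<nu> \<mu> x)"

abbreviation Ghat :: "('c::finite, 'n::{finite,linorder}) proto \<Rightarrow> ('c, 'n) gauge_field
    \<Rightarrow> 'n \<Rightarrow> 'n \<Rightarrow> real^('n::{finite,linorder}) \<Rightarrow> complex^'c^'c" where
  "Ghat \<G> A \<equiv> antisym_ext (deriv_P \<G> A)"

abbreviation Ghat_star :: "('c::finite, 'n::{finite,linorder}) proto \<Rightarrow> ('c, 'n) gauge_field
    \<Rightarrow> 'n \<Rightarrow> 'n \<Rightarrow> real^('n::{finite,linorder}) \<Rightarrow> complex^'c^'c" where
  "Ghat_star \<G> A \<equiv> antisym_ext (deriv_Q \<G> A)"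

section \<open>Euler-Lagrange equations\<close>

definition test_field :: "(complex^'c^'c) set \<Rightarrow> (real^'n \<Rightarrow> complex^'c^'c) \<Rightarrow> bool" where
  "test_field \<gg> H \<longleftrightarrow> smooth H \<and> range H \<subseteq> \<gg> \<and> compact (closure {x. H x \<noteq> 0})"

definition euler_lagrange ::
  "(complex^'c^'c) set \<Rightarrow> ('c::finite, 'n::finite) proto \<Rightarrow> ('c, 'n) gauge_field \<Rightarrow> bool" where
  "euler_lagrange \<gg> \<G> A \<longleftrightarrow>
     (\<forall>\<kappa> H. test_field \<gg> H \<longrightarrow>
        ((\<lambda>\<epsilon>::real. LINT x|lborel.
            lagrangian \<G> (A(\<kappa> := (\<lambda>y. A \<kappa> y + \<epsilon> *\<^sub>R H y))) x - lagrangian \<G> A x)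
          has_vector_derivative 0) (at 0))"

end

(* Replacing A_k by A_k + e H changes the field strength F exactly affinely, F + e B, with B built
   from the covariant derivatives of H. Differentiating under the integral gives the first
   variation D G (B, B^dagger); by the polarized reality condition the derivatives in the two kinds
   of arguments contribute complex conjugate terms, so it equals twice the integral of
   sum_mu <nabla_mu H, S_mu>, where < , > is the real trace form and S_mu is the projection of the
   starred derivative. For this form the adjoint of the commutator with A is the commutator with
   A^dagger, so an integration by parts moves the covariant derivative to S_mu^dagger; testing
   against bump functions times elements of the Lie algebra yields part A. If the Lie algebra is
   closed under adjoints, the two projected derivatives are adjoint to each other, which gives
   part B, and Q_J is the orthogonal projection on lie_J J, which gives part C. *)

theory Submission
  imports Defs
begin

section \<open>Continuously differentiable functions\<close>

text \<open>The real trace form need not be invariant under \<open>\<gg>\<close>: a commutator with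
  \<open>A \<mu> x\<close> moved across it becomes one with \<open>madj (A \<mu> x)\<close>, which
  may lead out of \<open>\<gg>\<close>. Hence the adjoints and the second, outer projection in part
  A, and hence their disappearance when \<open>\<gg>\<close> is closed under adjoints. The inner
  projection costs nothing because covariant derivatives of test fields stay in
  \<open>\<gg>\<close>; the outer one records that only \<open>\<gg>\<close>-valued fields are
  tested. One continuous derivative at a time is enough for the analysis: the field strength uses up
  one derivative of A, the integration by parts one of S_mu, and smoothness of A and of the
  proto-Lagrangian supplies both. Every integrand is continuous and vanishes off a box, so no
  question of convergence arises.\<close>

definition C1 :: "('a::real_normed_vector \<Rightarrow> 'b::real_normed_vector) \<Rightarrow> bool" where
  "C1 f \<longleftrightarrow> (\<forall>x. f differentiable (at x)) \<and>
     (\<forall>v. continuous_on UNIV (\<lambda>x. frechet_derivative f (at x) v))"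

lemma smooth_imp_C1: "smooth f \<Longrightarrow> C1 f"
  unfolding smooth_def C1_def by (metis times_differentiable.simps)

lemma smooth_frechet_derivative: "smooth f \<Longrightarrow> smooth (\<lambda>x. frechet_derivative f (at x) v)"
  unfolding smooth_def using times_differentiable.simps(2)[of f] by blast

lemma C1I:
  assumes "\<And>x. (f has_derivative f' x) (at x)" and "\<And>v. continuous_on UNIV (\<lambda>x. f' x v)"
  shows "C1 f"
proof -
  have "frechet_derivative f (at x) = f' x" for x
    using frechet_derivative_at[OF assms(1)[of x]] by simp
  with assms show ?thesis
    unfolding C1_def differentiable_def by auto
qed

lemma C1_has_derivative: "C1 f \<Longrightarrow> (f has_derivative frechet_derivative f (at x)) (at x)"
  unfolding C1_def using frechet_derivative_works by blast

lemma C1_continuous_derivative: "C1 f \<Longrightarrow> continuous_on S (\<lambda>x. frechet_derivative f (at x) v)"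
  unfolding C1_def using continuous_on_subset by blast

lemma C1_continuous_on: "C1 f \<Longrightarrow> continuous_on S f"
  unfolding C1_def by (meson differentiable_imp_continuous_within continuous_at_imp_continuous_on)

lemma C1_const: "C1 (\<lambda>x. c)"
  by (rule C1I[where f' = "\<lambda>x v. 0"]) auto

lemma C1_bounded_linear:
  assumes "bounded_linear L" "C1 f"
  shows "C1 (\<lambda>x. L (f x))"
proof (rule C1I)
  show "((\<lambda>x. L (f x)) has_derivative (\<lambda>v. L (frechet_derivative f (at x) v))) (at x)" for x
    by (rule bounded_linear.has_derivative[OF assms(1) C1_has_derivative[OF assms(2)]])
  show "continuous_on UNIV (\<lambda>x. L (frechet_derivative f (at x) v))" for v
    by (rule bounded_linear.continuous_on[OF assms(1) C1_continuous_derivative[OF assms(2)]])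
qed

lemma C1_bounded_bilinear:
  assumes "bounded_bilinear L" "C1 f" "C1 g"
  shows "C1 (\<lambda>x. L (f x) (g x))"
proof (rule C1I)
  show "((\<lambda>x. L (f x) (g x)) has_derivative
      (\<lambda>v. L (f x) (frechet_derivative g (at x) v) + L (frechet_derivative f (at x) v) (g x))) (at x)" for x
    by (rule bounded_bilinear.FDERIV[OF assms(1) C1_has_derivative[OF assms(2)] C1_has_derivative[OF assms(3)]])
  show "continuous_on UNIV
      (\<lambda>x. L (f x) (frechet_derivative g (at x) v) + L (frechet_derivative f (at x) v) (g x))" for v
    by (intro continuous_on_add bounded_bilinear.continuous_on[OF assms(1)]
        C1_continuous_derivative C1_continuous_on assms)
qed

lemma C1_add:
  assumes "C1 f" "C1 g"
  shows "C1 (\<lambda>x. f x + g x)"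
proof (rule C1I)
  show "((\<lambda>x. f x + g x) has_derivative
      (\<lambda>v. frechet_derivative f (at x) v + frechet_derivative g (at x) v)) (at x)" for x
    by (intro has_derivative_add C1_has_derivative assms)
  show "continuous_on UNIV (\<lambda>x. frechet_derivative f (at x) v + frechet_derivative g (at x) v)" for v
    by (intro continuous_on_add C1_continuous_derivative assms)
qed

lemma C1_uminus: "C1 f \<Longrightarrow> C1 (\<lambda>x. - f x)"
  by (rule C1_bounded_linear[OF bounded_linear_minus[OF bounded_linear_ident]])

lemma C1_diff: "C1 f \<Longrightarrow> C1 g \<Longrightarrow> C1 (\<lambda>x. f x - g x)"
  using C1_add[OF _ C1_uminus, of f g] by simp

lemma C1_sum: "(\<And>i. i \<in> I \<Longrightarrow> C1 (f i)) \<Longrightarrow> C1 (\<lambda>x. \<Sum>i\<in>I. f i x)"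
  by (induction I rule: infinite_finite_induct) (auto intro: C1_add C1_const)

lemma C1_Pair: 
  assumes "C1 f" "C1 g"
  shows "C1 (\<lambda>x. (f x, g x))"
proof (rule C1I)
  show "((\<lambda>x. (f x, g x)) has_derivative
      (\<lambda>v. (frechet_derivative f (at x) v, frechet_derivative g (at x) v))) (at x)" for x
    by (intro has_derivative_Pair C1_has_derivative assms)
  show "continuous_on UNIV (\<lambda>x. (frechet_derivative f (at x) v, frechet_derivative g (at x) v))" for v
    by (intro continuous_on_Pair C1_continuous_derivative assms)
qed

lemma C1_ident: "C1 (\<lambda>x. x)"
  by (rule C1I[where f' = "\<lambda>x v. v"]) auto

section \<open>Vector-valued functions and composition\<close>

lemma bounded_linear_axis: "bounded_linear (axis i :: 'a::euclidean_space \<Rightarrow> 'a^'n)"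
  by (simp add: linear_conv_bounded_linear[symmetric] linear_iff axis_def vec_eq_iff)

lemma vec_lambda_eq_sum_axis:
  fixes f :: "'n::finite \<Rightarrow> 'a::comm_monoid_add"
  shows "vec_lambda f = (\<Sum>i\<in>UNIV. axis i (f i))"
  by (simp add: vec_eq_iff axis_def if_distrib cong: if_cong)

lemma C1_vec_lambda:
  fixes f :: "'n::finite \<Rightarrow> 'a::real_normed_vector \<Rightarrow> 'b::euclidean_space"
  assumes "\<And>i. C1 (f i)"
  shows "C1 (\<lambda>x. \<chi> i. f i x)"
  unfolding vec_lambda_eq_sum_axis[of "\<lambda>i. f i _"]
  by (intro C1_sum C1_bounded_linear[OF bounded_linear_axis] assms)

text \<open>\<open>C1\<close> gives continuity for each fixed direction only. Expanding a moving
  direction in the finite \<open>Basis\<close> reduces to that case; this is where finite dimension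
  of the domain enters.\<close>

lemma C1_continuous_derivative_joint:
  fixes f :: "'a::euclidean_space \<Rightarrow> 'b::real_normed_vector"
  assumes "C1 f" "continuous_on S g" "continuous_on S h"
  shows "continuous_on S (\<lambda>x. frechet_derivative f (at (g x)) (h x))"
proof -
  have "frechet_derivative f (at (g x)) (h x) =
      (\<Sum>b\<in>Basis. (h x \<bullet> b) *\<^sub>R frechet_derivative f (at (g x)) b)" for x
  proof -
    have lin: "linear (frechet_derivative f (at (g x)))"
      using C1_has_derivative[OF assms(1)] has_derivative_linear by blast
    show ?thesis
      using linear_sum[OF lin, of "\<lambda>b. (h x \<bullet> b) *\<^sub>R b" Basis]
      by (simp add: euclidean_representation linear_cmul[OF lin])
  qed
  moreover have "continuous_on S (\<lambda>x. frechet_derivative f (at (g x)) b)" for b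
    using continuous_on_compose2[OF C1_continuous_derivative[OF assms(1), of UNIV b] assms(2)] by simp
  ultimately show ?thesis
    by (simp only:) (intro continuous_on_sum continuous_on_scaleR continuous_on_inner
        continuous_on_const assms)
qed

lemma C1_compose:
  fixes f :: "'a::euclidean_space \<Rightarrow> 'b::real_normed_vector"
  assumes "C1 f" "C1 g"
  shows "C1 (\<lambda>x. f (g x))"
proof (rule C1I)
  show "((\<lambda>x. f (g x)) has_derivative
      (\<lambda>v. frechet_derivative f (at (g x)) (frechet_derivative g (at x) v))) (at x)" for x
    using diff_chain_at[OF C1_has_derivative[OF assms(2)] C1_has_derivative[OF assms(1)]]
    by (simp add: o_def)
  show "continuous_on UNIV (\<lambda>x. frechet_derivative f (at (g x)) (frechet_derivative g (at x) v))" for v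
    by (intro C1_continuous_derivative_joint C1_continuous_derivative C1_continuous_on assms)
qed

section \<open>Partial derivatives\<close>

lemma partial_eqI:
  assumes "(V has_derivative V') (at x)"
  shows "partial \<mu> V x = V' (axis \<mu> 1)"
  unfolding partial_def using frechet_derivative_at[OF assms] by simp

lemma partial_bounded_linear:
  assumes "bounded_linear L" "C1 V"
  shows "partial \<mu> (\<lambda>y. L (V y)) x = L (partial \<mu> V x)"
  unfolding partial_def[of _ V]
  by (rule partial_eqI[OF bounded_linear.has_derivative[OF assms(1) C1_has_derivative[OF assms(2)]]])

lemma partial_bounded_bilinear:
  assumes "bounded_bilinear L" "C1 V" "C1 W"
  shows "partial \<mu> (\<lambda>y. L (V y) (W y)) x = L (V x) (partial \<mu> W x) + L (partial \<mu> V x) (W x)"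
  unfolding partial_def[of _ V] partial_def[of _ W]
  by (rule partial_eqI[OF bounded_bilinear.FDERIV[OF assms(1) C1_has_derivative[OF assms(2)] C1_has_derivative[OF assms(3)]]])

lemma C1_partial: "smooth V \<Longrightarrow> C1 (partial \<mu> V)"
  using smooth_imp_C1[OF smooth_frechet_derivative[of V "axis \<mu> 1"]]
  by (simp add: partial_def[abs_def])

lemma continuous_on_partial: "C1 V \<Longrightarrow> continuous_on S (partial \<mu> V)"
  using C1_continuous_derivative[of V S "axis \<mu> 1"] by (simp add: partial_def[abs_def])

text \<open>Difference quotients stay in S, and a finite-dimensional subspace is closed. This keeps
  derivatives of \<open>\<gg>\<close>-valued fields in \<open>\<gg>\<close>.\<close>

lemma frechet_derivative_in_subspace:
  fixes f :: "'a::real_normed_vector \<Rightarrow> 'b::euclidean_space"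
  assumes "subspace S" "f differentiable (at x)" "range f \<subseteq> S"
  shows "frechet_derivative f (at x) v \<in> S"
proof -
  have "(f has_derivative frechet_derivative f (at x)) (at x)"
    using assms(2) frechet_derivative_works by blast
  moreover have "((\<lambda>t::real. x + t *\<^sub>R v) has_derivative (\<lambda>t. t *\<^sub>R v)) (at 0)"
    by (auto intro!: derivative_eq_intros)
  ultimately have "((\<lambda>t::real. f (x + t *\<^sub>R v)) has_derivative
      (\<lambda>t. frechet_derivative f (at x) (t *\<^sub>R v))) (at 0)"
    using diff_chain_at[of "\<lambda>t::real. x + t *\<^sub>R v" _ 0 f] by (simp add: o_def)
  moreover have "linear (frechet_derivative f (at x))"
    using assms(2) linear_frechet_derivative by blast
  ultimately have "((\<lambda>t::real. f (x + t *\<^sub>R v)) has_vector_derivative frechet_derivative f (at x) v) (at 0)"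
    by (simp add: has_vector_derivative_def linear_cmul)
  then have "((\<lambda>t. norm (f (x + t *\<^sub>R v) - f x - t *\<^sub>R frechet_derivative f (at x) v) / \<bar>t\<bar>) \<longlongrightarrow> 0) (at 0)"
    by (simp add: has_vector_derivative_def has_derivative_at)
  moreover have "norm (f (x + t *\<^sub>R v) - f x - t *\<^sub>R frechet_derivative f (at x) v) / \<bar>t\<bar> =
      norm ((f (x + t *\<^sub>R v) - f x) /\<^sub>R t - frechet_derivative f (at x) v)" if "t \<noteq> 0" for t
  proof -
    have "f (x + t *\<^sub>R v) - f x - t *\<^sub>R frechet_derivative f (at x) v =
        t *\<^sub>R ((f (x + t *\<^sub>R v) - f x) /\<^sub>R t - frechet_derivative f (at x) v)"
      using that by (simp add: scaleR_diff_right)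
    then show ?thesis using that by simp
  qed
  ultimately have "((\<lambda>t. norm ((f (x + t *\<^sub>R v) - f x) /\<^sub>R t - frechet_derivative f (at x) v)) \<longlongrightarrow> 0) (at 0)"
    by (simp cong: LIM_cong)
  then have lim: "((\<lambda>t. (f (x + t *\<^sub>R v) - f x) /\<^sub>R t) \<longlongrightarrow> frechet_derivative f (at x) v) (at 0)"
    by (rule LIM_zero_cancel[OF tendsto_norm_zero_cancel])
  have "closed S" by (rule closed_subspace[OF assms(1)])
  then show ?thesis
    using Lim_in_closed_set[OF \<open>closed S\<close> _ _ lim] assms(1,3)
    by (auto simp: subspace_diff subspace_scale image_subset_iff intro!: always_eventually)
qed

section \<open>Differentiation under the integral sign\<close>

text \<open>A bridge between two integrals: the equations are about \<open>lborel\<close>, whereas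
  the Leibniz rule applied below concerns \<open>integral\<close> over a box.\<close>

lemma
  fixes f :: "'a::euclidean_space \<Rightarrow> 'b::euclidean_space"
  assumes "continuous_on UNIV f" and "\<And>x. x \<notin> cbox a b \<Longrightarrow> f x = 0"
  shows LINT_eq_integral_cbox: "(LINT x|lborel. f x) = integral (cbox a b) f"
    and integrable_of_continuous: "integrable lborel f"
proof -
  have eq: "(\<lambda>x. indicator (cbox a b) x *\<^sub>R f x) = f"
    using assms(2) by (auto simp: indicator_def)
  have "set_integrable lborel (cbox a b) f"
    unfolding set_integrable_def
    by (intro borel_integrable_compact compact_cbox continuous_on_subset[OF assms(1)]) auto
  then show "integrable lborel f" "(LINT x|lborel. f x) = integral (cbox a b) f"
    using set_borel_integral_eq_integral(2)[of "cbox a b" f] eq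
    by (auto simp: set_integrable_def set_lebesgue_integral_def)
qed

lemma LINT_has_vector_derivative:
  fixes f :: "real \<Rightarrow> 'a::euclidean_space \<Rightarrow> 'b::euclidean_space"
  assumes deriv: "\<And>t x. ((\<lambda>t. f t x) has_vector_derivative f' t x) (at t)"
    and cont: "continuous_on UNIV (\<lambda>(t, x). f' t x)" "\<And>t. continuous_on UNIV (f t)"
    and zero: "\<And>t x. \<bar>t\<bar> < 1 \<Longrightarrow> x \<notin> cbox a b \<Longrightarrow> f t x = 0"
  shows "((\<lambda>t. LINT x|lborel. f t x) has_vector_derivative (LINT x|lborel. f' 0 x)) (at 0)"
proof -
  define U where "U = {-1<..<1::real}"
  have U: "0 \<in> U" "convex U" "open U" by (auto simp: U_def)
  have eq: "(LINT x|lborel. f t x) = integral (cbox a b) (f t)" if "t \<in> U" for t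
    using that by (intro LINT_eq_integral_cbox cont zero) (auto simp: U_def)
  \<comment> \<open>Off the box the function of t is constantly 0 near t = 0, so its derivative
    there is 0.\<close>
  have zero': "f' 0 x = 0" if "x \<notin> cbox a b" for x
  proof -
    have "((\<lambda>t. f t x) has_vector_derivative 0) (at 0)"
      by (rule has_vector_derivative_transform_within_open[of "\<lambda>t. 0" _ _ U])
         (use U that in \<open>auto simp: zero U_def\<close>)
    with deriv show ?thesis
      using vector_derivative_unique_at by blast
  qed
  have "continuous_on UNIV (f' 0)"
    using continuous_on_compose2[OF cont(1), of UNIV "\<lambda>x. (0, x)"] by (simp add: continuous_on_Pair)
  then have eq': "(LINT x|lborel. f' 0 x) = integral (cbox a b) (f' 0)"
    by (intro LINT_eq_integral_cbox zero')
  have "((\<lambda>t. integral (cbox a b) (f t)) has_vector_derivative integral (cbox a b) (f' 0)) (at 0 within U)"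
    by (rule leibniz_rule_vector_derivative)
       (use U in \<open>auto intro!: has_vector_derivative_at_within deriv integrable_continuous
         continuous_on_subset[OF cont(2)] continuous_on_subset[OF cont(1)]\<close>)
  then have "((\<lambda>t. integral (cbox a b) (f t)) has_vector_derivative integral (cbox a b) (f' 0)) (at 0)"
    using U at_within_open by metis
  then show ?thesis
    unfolding eq'
    by (rule has_vector_derivative_transform_within_open[OF _ U(3) U(1)]) (simp add: eq)
qed

lemma LINT_translation:
  fixes f :: "'a::euclidean_space \<Rightarrow> 'b::euclidean_space"
  assumes "f \<in> borel_measurable borel"
  shows "(LINT x|lborel. f (v + x)) = (LINT x|lborel. f x)"
  using lborel_distr_plus[of v] integral_distr[of "(+) v" lborel borel f] assms by simp

text \<open>By translation invariance the integral of g(t e + x) over x does not depend on t; its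
  derivative at t = 0 is the integral of the partial derivative. Neither iterated integrals nor
  boundary terms occur.\<close>

lemma LINT_partial_eq_0:
  fixes g :: "real^'n \<Rightarrow> real"
  assumes "C1 g" and "bounded {x. g x \<noteq> 0}"
  shows "(LINT x|lborel. partial \<mu> g x) = 0"
proof -
  define e :: "real^'n" where "e = axis \<mu> 1"
  obtain r where r: "\<And>x. g x \<noteq> 0 \<Longrightarrow> norm x \<le> r"
    using assms(2) by (auto simp: bounded_iff)
  \<comment> \<open>The extra 1 leaves room for all shifts by t e with |t| < 1, since e has norm
    1.\<close>
  obtain a b :: "real^'n" where ab: "cball 0 (r + 1) \<subseteq> cbox a b"
    using bounded_subset_cbox_symmetric[OF bounded_cball] by blast
  have ne: "norm e = 1" by (simp add: e_def)
  have "((\<lambda>t. LINT x|lborel. g (t *\<^sub>R e + x)) has_vector_derivative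
      (LINT x|lborel. frechet_derivative g (at (0 *\<^sub>R e + x)) e)) (at 0)"
  proof (rule LINT_has_vector_derivative)
    show "((\<lambda>t. g (t *\<^sub>R e + x)) has_vector_derivative frechet_derivative g (at (t *\<^sub>R e + x)) e) (at t)" for t x
    proof -
      have "((\<lambda>t. t *\<^sub>R e + x) has_derivative (\<lambda>s. s *\<^sub>R e)) (at t)"
        by (auto intro!: derivative_eq_intros)
      then have "((\<lambda>t. g (t *\<^sub>R e + x)) has_derivative (\<lambda>s. frechet_derivative g (at (t *\<^sub>R e + x)) (s *\<^sub>R e))) (at t)"
        using diff_chain_at[OF _ C1_has_derivative[OF assms(1)], of "\<lambda>t. t *\<^sub>R e + x"] by (simp add: o_def)
      moreover have "linear (frechet_derivative g (at (t *\<^sub>R e + x)))"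
        using C1_has_derivative[OF assms(1)] has_derivative_linear by blast
      ultimately show ?thesis
        by (simp add: has_vector_derivative_def linear_cmul)
    qed
    show "continuous_on UNIV (\<lambda>(t, x). frechet_derivative g (at (t *\<^sub>R e + x)) e)"
      unfolding split_beta
      by (intro C1_continuous_derivative_joint assms continuous_intros)
    show "continuous_on UNIV (\<lambda>x. g (t *\<^sub>R e + x))" for t
      by (intro continuous_on_compose2[OF C1_continuous_on[OF assms(1), of UNIV]] continuous_intros) auto
    show "g (t *\<^sub>R e + x) = 0" if "\<bar>t\<bar> < 1" "x \<notin> cbox a b" for t x
    proof (rule ccontr)
      assume "g (t *\<^sub>R e + x) \<noteq> 0"
      from r[OF this] have "norm x \<le> r + norm (t *\<^sub>R e)"
        using norm_triangle_ineq4[of "t *\<^sub>R e + x" "t *\<^sub>R e"] by simp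
      then have "x \<in> cball 0 (r + 1)" using that ne by simp
      with ab that show False by blast
    qed
  qed
  moreover have "(\<lambda>t. LINT x|lborel. g (t *\<^sub>R e + x)) = (\<lambda>t. LINT x|lborel. g x)"
    using LINT_translation[of g] borel_measurable_continuous_onI[OF C1_continuous_on[OF assms(1)]] by auto
  ultimately have "((\<lambda>t::real. LINT x|lborel. g x) has_vector_derivative (LINT x|lborel. partial \<mu> g x)) (at 0)"
    by (simp add: partial_def e_def)
  then show ?thesis
    using vector_derivative_unique_at[OF _ has_vector_derivative_const] by blast
qed

section \<open>Bump functions and the fundamental lemma\<close>

text \<open>The classical flat function exp(-1/t), times powers of 1/t so that the family is closed
  under differentiation up to linear combinations.\<close>

definition flat :: "nat \<Rightarrow> real \<Rightarrow> real" where
  "flat k t = (if t > 0 then inverse t ^ k * exp (- inverse t) else 0)"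

lemma flat_tendsto_0: "((\<lambda>t. inverse t ^ k * exp (- inverse t)) \<longlongrightarrow> 0) (at_right (0::real))"
proof -
  have "((\<lambda>x::real. x ^ k / exp x) \<longlongrightarrow> 0) at_top"
    by (rule tendsto_power_div_exp_0)
  then have "((\<lambda>t::real. inverse t ^ k / exp (inverse t)) \<longlongrightarrow> 0) (at_right 0)"
    by (rule filterlim_compose[OF _ filterlim_inverse_at_top_right])
  then show ?thesis
    by (simp add: exp_minus divide_inverse)
qed

lemma flat_has_field_derivative:
  "(flat k has_real_derivative - real k * flat (k + 1) t + flat (k + 2) t) (at t)"
proof (cases t "0::real" rule: linorder_cases)
  case less
  have "(flat k has_real_derivative 0) (at t)"
    by (rule has_field_derivative_transform_within_open[of "\<lambda>t. 0" _ _ "{..<0}"])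
       (use less in \<open>auto simp: flat_def\<close>)
  with less show ?thesis by (simp add: flat_def)
next
  case equal
  have "((\<lambda>s. flat (k + 1) s) \<longlongrightarrow> 0) (at_right 0)"
    by (rule Lim_transform_eventually[OF flat_tendsto_0[of "k + 1"]])
       (auto simp: flat_def eventually_at_filter)
  moreover have "((\<lambda>s. flat (k + 1) s) \<longlongrightarrow> 0) (at_left 0)"
    by (rule Lim_transform_eventually[OF tendsto_const]) (auto simp: flat_def eventually_at_filter)
  ultimately have "((\<lambda>s. flat (k + 1) s) \<longlongrightarrow> 0) (at 0)"
    by (simp add: filterlim_at_split)
  \<comment> \<open>Dividing by s only raises the index, so differentiability at 0 reduces to the
    limit just found, for k + 1.\<close>
  moreover have "(flat k s - flat k 0) / (s - 0) = flat (k + 1) s" for s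
    by (simp add: flat_def divide_inverse)
  ultimately show ?thesis
    using equal by (simp add: has_field_derivative_iff flat_def)
next
  case greater
  have "((\<lambda>t. inverse t ^ k * exp (- inverse t)) has_real_derivative
      real k * inverse t ^ (k - 1) * - (inverse t)\<^sup>2 * exp (- inverse t) +
      (inverse t)\<^sup>2 * exp (- inverse t) * inverse t ^ k) (at t)"
    using greater by (auto intro!: derivative_eq_intros simp: power2_eq_square)
  also have "real k * inverse t ^ (k - 1) * - (inverse t)\<^sup>2 * exp (- inverse t) +
      (inverse t)\<^sup>2 * exp (- inverse t) * inverse t ^ k =
      - real k * flat (k + 1) t + flat (k + 2) t"
    \<comment> \<open>The exponent k - 1 is truncated at k = 0, where the factor
      \<open>real k\<close> removes the term.\<close>
    using greater by (cases k) (simp_all add: flat_def power2_eq_square algebra_simps)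
  finally have "((\<lambda>t. inverse t ^ k * exp (- inverse t)) has_real_derivative
      - real k * flat (k + 1) t + flat (k + 2) t) (at t)" .
  then show ?thesis
    by (rule has_field_derivative_transform_within_open[of _ _ _ "{0<..}"])
       (use greater in \<open>auto simp: flat_def\<close>)
qed

text \<open>A class of functions closed under directional derivatives consists of smooth functions.\<close>

inductive bump_class :: "('a::euclidean_space \<Rightarrow> real) \<Rightarrow> bool" where
  const: "bump_class (\<lambda>x. c)"
| inner: "bump_class (\<lambda>x. v \<bullet> x)"
| flat: "bump_class (\<lambda>x. flat k (r - (x - a) \<bullet> (x - a)))"
| add: "bump_class f \<Longrightarrow> bump_class g \<Longrightarrow> bump_class (\<lambda>x. f x + g x)"
| mult: "bump_class f \<Longrightarrow> bump_class g \<Longrightarrow> bump_class (\<lambda>x. f x * g x)"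

lemma bump_class_has_derivative:
  assumes "bump_class f"
  shows "\<exists>f'. (\<forall>x. (f has_derivative f' x) (at x)) \<and> (\<forall>v. bump_class (\<lambda>x. f' x v))"
  using assms
proof induction
  case (const c)
  show ?case
    by (rule exI[where x = "\<lambda>x v. 0"]) (auto intro: bump_class.const)
next
  case (inner v)
  show ?case
    by (rule exI[where x = "\<lambda>x w. v \<bullet> w"])
       (auto intro!: bump_class.const derivative_eq_intros)
next
  case (flat k r a)
  \<comment> \<open>The derivative is written with products and sums only, so that for fixed v the
    rules of \<open>bump_class\<close> apply to it literally.\<close>
  have "((\<lambda>x. flat k (r - (x - a) \<bullet> (x - a))) has_derivative
      (\<lambda>v. (- real k * flat (k + 1) (r - (x - a) \<bullet> (x - a)) + flat (k + 2) (r - (x - a) \<bullet> (x - a))) *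
        ((- 2) * (v \<bullet> x + - (v \<bullet> a))))) (at x)" for x
  proof -
    have "((\<lambda>x. r - (x - a) \<bullet> (x - a)) has_derivative (\<lambda>v. (- 2) * (v \<bullet> x + - (v \<bullet> a)))) (at x)"
      by (auto intro!: derivative_eq_intros simp: inner_commute algebra_simps)
    from has_derivative_compose[OF this flat_has_field_derivative[unfolded has_field_derivative_def]]
    show ?thesis by simp
  qed
  then show ?case
    by (intro exI[where x = "\<lambda>x v. (- real k * flat (k + 1) (r - (x - a) \<bullet> (x - a)) + flat (k + 2) (r - (x - a) \<bullet> (x - a))) *
        ((- 2) * (v \<bullet> x + - (v \<bullet> a)))"] conjI allI)
       (blast, intro bump_class.intros)
next
  case (add f g)
  then obtain f' g' where
    "\<forall>x. (f has_derivative f' x) (at x)" "\<forall>v. bump_class (\<lambda>x. f' x v)"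
    "\<forall>x. (g has_derivative g' x) (at x)" "\<forall>v. bump_class (\<lambda>x. g' x v)" by blast
  then show ?case
    by (intro exI[where x = "\<lambda>x v. f' x v + g' x v"])
       (auto intro!: bump_class.add has_derivative_add)
next
  case (mult f g)
  then obtain f' g' where
    "\<forall>x. (f has_derivative f' x) (at x)" "\<forall>v. bump_class (\<lambda>x. f' x v)"
    "\<forall>x. (g has_derivative g' x) (at x)" "\<forall>v. bump_class (\<lambda>x. g' x v)" by blast
  with mult.hyps show ?case
    by (intro exI[where x = "\<lambda>x v. f x * g' x v + f' x v * g x"])
       (auto intro!: bump_class.add bump_class.mult has_derivative_mult)
qed

text \<open>The fixed vector c passes through every derivative, so the induction on the order only
  meets scalar functions of the class; f must vary in it.\<close>

lemma bump_class_smooth_scaleR: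
  assumes "bump_class f"
  shows "smooth (\<lambda>x. f x *\<^sub>R (c::'b::real_normed_vector))"
proof -
  have "times_differentiable (\<lambda>x. f x *\<^sub>R c) k" for k
    using assms
  proof (induction k arbitrary: f)
    case 0
    obtain f' where f': "\<And>x. (f has_derivative f' x) (at x)"
      using bump_class_has_derivative[OF 0] by blast
    then have "continuous_on UNIV f"
      by (meson continuous_at_imp_continuous_on has_derivative_continuous)
    then show ?case by (simp add: continuous_on_scaleR)
  next
    case (Suc k)
    obtain f' where f': "\<And>x. (f has_derivative f' x) (at x)" "\<And>v. bump_class (\<lambda>x. f' x v)"
      using bump_class_has_derivative[OF Suc.prems] by blast
    have der: "((\<lambda>x. f x *\<^sub>R c) has_derivative (\<lambda>v. f' x v *\<^sub>R c)) (at x)" for x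
      using has_derivative_scaleR_left[OF f'(1)] .
    then have eq: "frechet_derivative (\<lambda>x. f x *\<^sub>R c) (at x) = (\<lambda>v. f' x v *\<^sub>R c)" for x
      using frechet_derivative_at by metis
    show ?case
      using der Suc.IH[OF f'(2)] by (auto simp: eq differentiable_def)
  qed
  then show ?thesis by (simp add: smooth_def)
qed

text \<open>The fundamental lemma of the calculus of variations: if w does not vanish at x0, it has
  constant sign on a ball, and a bump positive exactly there forces the ball to have measure
  0.\<close>

lemma continuous_eq_0_if_orthogonal_to_bumps:
  fixes w :: "'a::euclidean_space \<Rightarrow> real"
  assumes cont: "continuous_on UNIV w"
    and int: "\<And>\<phi>. bump_class \<phi> \<Longrightarrow> bounded {x. \<phi> x \<noteq> 0} \<Longrightarrow> (LINT x|lborel. \<phi> x * w x) = 0"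
  shows "w x0 = 0"
proof (rule ccontr)
  assume ne: "w x0 \<noteq> 0"
  \<comment> \<open>The sign factor makes u positive at x0, so one case suffices.\<close>
  define u where "u x = sgn (w x0) * w x" for x
  have u: "continuous_on UNIV u" "u x0 > 0"
    using ne by (auto simp: u_def abs_sgn[symmetric] mult.commute intro!: continuous_on_mult cont)
  have "open {x. 0 < u x}"
    using open_Collect_less[OF continuous_on_const u(1)] .
  with u(2) obtain e where e: "e > 0" "ball x0 e \<subseteq> {x. 0 < u x}"
    by (metis (no_types, lifting) mem_Collect_eq open_contains_ball)
  \<comment> \<open>The argument of \<open>flat\<close> is positive exactly on the open ball of
    radius e about x0.\<close>
  define \<phi> where "\<phi> x = flat 0 (e\<^sup>2 - (x - x0) \<bullet> (x - x0))" for x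
  have flat_pos: "\<phi> x > 0 \<longleftrightarrow> x \<in> ball x0 e" "\<phi> x \<ge> 0" "\<phi> x = 0 \<longleftrightarrow> x \<notin> ball x0 e" for x
    using e(1) abs_le_square_iff[of e "norm (x0 - x)"]
    by (auto simp: \<phi>_def flat_def dist_norm norm_minus_commute[of x] power2_norm_eq_inner[symmetric] not_le[symmetric])
  have bump: "bump_class \<phi>"
    unfolding \<phi>_def by (rule bump_class.flat)
  then have contphi: "continuous_on UNIV \<phi>"
    using bump_class_has_derivative[OF bump]
    by (meson continuous_at_imp_continuous_on has_derivative_continuous)
  have bd: "bounded {x. \<phi> x \<noteq> 0}"
    by (rule bounded_subset[OF bounded_ball[of x0 e]]) (auto simp: flat_pos)
  from int[OF bump bd] have "(LINT x|lborel. \<phi> x * u x) = 0"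
    by (simp add: u_def mult.left_commute[of _ "sgn (w x0)"])
  moreover obtain a b :: 'a where ab: "ball x0 e \<subseteq> cbox a b"
    using bounded_subset_cbox_symmetric[OF bounded_ball] by blast
  have contpu: "continuous_on UNIV (\<lambda>x. \<phi> x * u x)"
    by (intro continuous_on_mult contphi u)
  have nonneg: "0 \<le> \<phi> x * u x" for x
    using flat_pos[of x] e(2) by (cases "x \<in> ball x0 e") (auto simp: less_imp_le)
  have zero: "\<phi> x * u x = 0" if "x \<notin> cbox a b" for x
    using that ab flat_pos(3)[of x] by auto
  have "integrable lborel (\<lambda>x. \<phi> x * u x)"
    by (rule integrable_of_continuous[OF contpu zero])
  ultimately have "AE x in lborel. \<phi> x * u x = 0"
    using integral_nonneg_eq_0_iff_AE[of lborel "\<lambda>x. \<phi> x * u x"] nonneg by auto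
  then have "AE x in lborel. x \<notin> ball x0 e"
    by eventually_elim (use flat_pos e(2) in force)
  then have "emeasure lborel (ball x0 e) = 0"
    by (subst (asm) AE_iff_null) (auto simp: null_sets_def ball_def)
  then have "ball x0 e \<in> null_sets lebesgue"
    by (simp add: null_sets_def)
  then have "negligible (ball x0 e)"
    by (simp add: negligible_iff_null_sets)
  then show False
    using open_not_negligible[of "ball x0 e"] e(1) by auto
qed

section \<open>Matrices\<close>

text \<open>Identifies the real trace form with the Euclidean inner product of the type, so that
  general facts on orthogonality apply.\<close>

lemma mat_inner_eq_inner: "mat_inner X Y = X \<bullet> Y"
proof -
  have "mat_inner X Y = (\<Sum>i\<in>UNIV. \<Sum>j\<in>UNIV. Re (cnj (X $ j $ i) * Y $ j $ i))"
    by (simp add: mat_inner_def trace_def matrix_matrix_mult_def madj_def)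
  also have "\<dots> = X \<bullet> Y"
    by (subst sum.swap) (simp add: inner_vec_def inner_complex_def)
  finally show ?thesis .
qed

lemma madj_madj [simp]: "madj (madj X) = X"
  by (simp add: madj_def vec_eq_iff)

lemma madj_mult: "madj (X ** Y) = madj Y ** madj X"
  by (simp add: madj_def vec_eq_iff matrix_matrix_mult_def mult.commute)

lemma bounded_linear_madj: "bounded_linear (madj :: complex^'q^'p \<Rightarrow> _)"
  by (simp add: linear_conv_bounded_linear[symmetric] linear_iff madj_def vec_eq_iff)

lemmas madj_simps = linear_add[OF bounded_linear.linear[OF bounded_linear_madj]]
  linear_diff[OF bounded_linear.linear[OF bounded_linear_madj]]
  linear_neg[OF bounded_linear.linear[OF bounded_linear_madj]]
  linear_0[OF bounded_linear.linear[OF bounded_linear_madj]]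
  linear_sum[OF bounded_linear.linear[OF bounded_linear_madj]]
  linear_scale[OF bounded_linear.linear[OF bounded_linear_madj]]

lemma inner_eq_Re_trace: "X \<bullet> Y = Re (trace (madj X ** Y))" for X Y :: "complex^'c^'c"
  using mat_inner_eq_inner[of X Y] by (simp add: mat_inner_def)

lemma trace_madj: "trace (madj X) = cnj (trace X)"
  by (simp add: trace_def madj_def)

lemma inner_madj: "madj X \<bullet> madj Y = X \<bullet> Y" for X Y :: "complex^'c^'c"
proof -
  have "trace (X ** madj Y) = cnj (trace (Y ** madj X))"
    unfolding trace_madj[symmetric] madj_mult by simp
  then show ?thesis
    by (simp add: inner_eq_Re_trace trace_mul_sym[of Y])
qed

lemma matrix_mult_scaleR: "(c *\<^sub>R X) ** Y = c *\<^sub>R (X ** Y)" "X ** (c *\<^sub>R Y) = c *\<^sub>R (X ** Y)"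
  for X Y :: "complex^'c^'c"
  by (simp_all add: vec_eq_iff matrix_matrix_mult_def scaleR_sum_right)

lemma matrix_mult_linear: "(X - Y) ** Z = X ** Z - Y ** Z" "Z ** (X - Y) = Z ** X - Z ** Y"
  "(X + Y) ** Z = X ** Z + Y ** Z" "Z ** (X + Y) = Z ** X + Z ** Y"
  "(- X) ** Z = - (X ** Z)" "Z ** (- X) = - (Z ** X)" for X Y Z :: "complex^'c^'c"
  by (simp_all add: vec_eq_iff matrix_matrix_mult_def algebra_simps sum.distrib
      sum_subtractf sum_negf)

lemma bounded_bilinear_comm: "bounded_bilinear comm"
  unfolding bilinear_conv_bounded_bilinear[symmetric] bilinear_def linear_iff comm_def
  by (auto simp: matrix_mult_scaleR matrix_mult_linear scaleR_diff_right)

lemma comm_skew: "comm Y X = - comm X Y"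
  by (simp add: comm_def)

lemma madj_comm: "madj (comm X Y) = comm (madj Y) (madj X)"
  by (simp add: comm_def madj_simps madj_mult)

text \<open>Cyclicity of the trace. The adjoint on X is the source of all adjoints in the general
  equations.\<close>

lemma inner_comm: "comm X Y \<bullet> Z = Y \<bullet> comm (madj X) Z"
proof -
  have "trace (madj X ** madj Y ** Z) = trace (madj Y ** (Z ** madj X))"
    by (metis matrix_mul_assoc trace_mul_sym)
  then have "trace (madj (comm X Y) ** Z) = trace (madj Y ** comm (madj X) Z)"
    by (simp add: comm_def madj_simps madj_mult matrix_mult_linear trace_sub matrix_mul_assoc)
  then show ?thesis
    by (simp add: inner_eq_Re_trace)
qed

section \<open>The orthogonal projection\<close>

text \<open>Justifies the \<open>THE\<close> in \<open>proj\<close>. Two candidates differ by an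
  element of S that is orthogonal to itself.\<close>

lemma ex1_orthogonal_projection:
  fixes S :: "'a::euclidean_space set"
  assumes "subspace S"
  shows "\<exists>!y. y \<in> S \<and> (\<forall>x\<in>S. x \<bullet> (z - y) = 0)"
proof -
  obtain y v where yv: "y \<in> span S" "\<And>w. w \<in> span S \<Longrightarrow> orthogonal v w" "z = y + v"
    using orthogonal_subspace_decomp_exists by blast
  have sp: "span S = S" using assms by (simp add: span_eq_iff)
  show ?thesis
  proof (rule ex1I[of _ y])
    show "y \<in> S \<and> (\<forall>x\<in>S. x \<bullet> (z - y) = 0)"
      using yv sp by (auto simp: orthogonal_def inner_commute)
    fix y' assume y': "y' \<in> S \<and> (\<forall>x\<in>S. x \<bullet> (z - y') = 0)"
    have "y' - y \<in> S" using y' yv sp assms by (simp add: subspace_diff)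
    then have "(y' - y) \<bullet> (z - y') = 0" "(y' - y) \<bullet> (z - y) = 0"
      using y' yv(2)[of "y' - y"] yv(3) sp by (simp_all add: orthogonal_def inner_commute[of v])
    then have "(y' - y) \<bullet> (y' - y) = 0"
      by (simp add: inner_diff_right)
    then show "y' = y" by simp
  qed
qed

context
  fixes \<gg> :: "(complex^'c^'c) set"
  assumes sub: "subspace \<gg>"
begin

lemma proj_in: "proj \<gg> Z \<in> \<gg>"
  and inner_proj_diff: "X \<in> \<gg> \<Longrightarrow> X \<bullet> (Z - proj \<gg> Z) = 0"
  using theI'[OF ex1_orthogonal_projection[OF sub, of Z]]
  by (auto simp: proj_def mat_inner_eq_inner)

lemma inner_proj: "X \<in> \<gg> \<Longrightarrow> X \<bullet> proj \<gg> Z = X \<bullet> Z"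
  using inner_proj_diff[of X Z] by (simp add: inner_diff_right)

text \<open>From here on, projections are identified by testing against \<open>\<gg>\<close>:
  linearity, compatibility with adjoints and the formula for \<open>Q_J\<close> all follow this
  way.\<close>

lemma proj_eqI: "Y \<in> \<gg> \<Longrightarrow> (\<And>X. X \<in> \<gg> \<Longrightarrow> X \<bullet> Y = X \<bullet> Z) \<Longrightarrow> proj \<gg> Z = Y"
  unfolding proj_def mat_inner_eq_inner
  by (rule the1_equality[OF ex1_orthogonal_projection[OF sub]]) (auto simp: inner_diff_right)

lemma proj_id: "Z \<in> \<gg> \<Longrightarrow> proj \<gg> Z = Z"
  by (rule proj_eqI) auto

lemma bounded_linear_proj: "bounded_linear (proj \<gg>)"
proof -
  have "proj \<gg> (X + Y) = proj \<gg> X + proj \<gg> Y" for X Y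
    by (rule proj_eqI) (auto simp: subspace_add[OF sub] proj_in inner_add_right inner_proj)
  moreover have "proj \<gg> (c *\<^sub>R X) = c *\<^sub>R proj \<gg> X" for c X
    by (rule proj_eqI) (auto simp: subspace_scale[OF sub] proj_in inner_proj)
  ultimately show ?thesis
    by (simp add: linear_conv_bounded_linear[symmetric] linear_iff)
qed

lemma proj_eq_0_iff: "proj \<gg> Z = 0 \<longleftrightarrow> (\<forall>X\<in>\<gg>. X \<bullet> Z = 0)"
  using inner_proj proj_eqI[of 0 Z] subspace_0[OF sub] by (metis inner_zero_right)

text \<open>The adjoint is an isometry that preserves \<open>\<gg>\<close>, hence commutes with the
  orthogonal projection.\<close>

lemma proj_madj:
  assumes "madj ` \<gg> = \<gg>"
  shows "proj \<gg> (madj Z) = madj (proj \<gg> Z)"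
proof (rule proj_eqI)
  show "madj (proj \<gg> Z) \<in> \<gg>" using assms proj_in by blast
  fix X assume "X \<in> \<gg>"
  then have "madj X \<in> \<gg>" using assms by blast
  then show "X \<bullet> madj (proj \<gg> Z) = X \<bullet> madj Z"
    using inner_proj[of "madj X" Z] inner_madj[of "madj X"] by simp
qed

end

section \<open>Supports and test fields\<close>

lemma has_derivative_outside_support:
  assumes "x \<notin> closure {y. f y \<noteq> 0}"
  shows "(f has_derivative (\<lambda>v. 0)) (at x)"
proof -
  have "((\<lambda>y. 0) has_derivative (\<lambda>v. 0)) (at x)" by simp
  moreover have "open (- closure {y. f y \<noteq> 0})" by (rule open_Compl[OF closed_closure])
  ultimately show ?thesis
    by (rule has_derivative_transform_within_open)
       (use assms closure_subset[of "{y. f y \<noteq> 0}"] in auto)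
qed

lemma partial_outside_support: "x \<notin> closure {y. f y \<noteq> 0} \<Longrightarrow> partial \<mu> f x = 0"
  by (rule partial_eqI[OF has_derivative_outside_support])

lemma test_fieldD:
  assumes "test_field \<gg> H"
  shows "C1 H" "H x \<in> \<gg>" "bounded {x. H x \<noteq> 0}" "\<exists>a b. closure {x. H x \<noteq> 0} \<subseteq> cbox a b"
proof -
  show "C1 H" "H x \<in> \<gg>" using assms by (auto simp: test_field_def smooth_imp_C1)
  have "bounded (closure {x. H x \<noteq> 0})"
    using assms by (auto simp: test_field_def compact_imp_bounded)
  then show "\<exists>a b. closure {x. H x \<noteq> 0} \<subseteq> cbox a b"
    using bounded_subset_cbox_symmetric by metis
  show "bounded {x. H x \<noteq> 0}"
    by (rule bounded_subset[OF \<open>bounded (closure _)\<close> closure_subset])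
qed

lemma bump_test_field:
  assumes "subspace \<gg>" "X \<in> \<gg>" "bump_class \<phi>" "bounded {x. \<phi> x \<noteq> 0}"
  shows "test_field \<gg> (\<lambda>x. \<phi> x *\<^sub>R X)"
proof -
  have "bounded {x. \<phi> x *\<^sub>R X \<noteq> 0}"
    by (rule bounded_subset[OF assms(4)]) auto
  then show ?thesis
    using assms by (auto simp: test_field_def bump_class_smooth_scaleR subspace_scale compact_closure)
qed

section \<open>The weak form of the equations\<close>

text \<open>Closure under commutators is used here, and again for the field strength.\<close>

lemma cov_deriv_in:
  assumes "matrix_lie_algebra \<gg>" "A \<mu> x \<in> \<gg>" "C1 V" "range V \<subseteq> \<gg>"
  shows "cov_deriv A \<mu> V x \<in> \<gg>"
proof -
  have "partial \<mu> V x \<in> \<gg>"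
    unfolding partial_def using assms
    by (intro frechet_derivative_in_subspace) (auto simp: matrix_lie_algebra_def C1_def)
  with assms show ?thesis
    by (auto simp: cov_deriv_def matrix_lie_algebra_def intro!: subspace_diff)
qed

text \<open>Adjoints inside and outside reverse the commutator, and its skew symmetry turns the
  sign: up to a minus sign the result is the formal adjoint of the covariant derivative.\<close>

lemma madj_cov_deriv_madj:
  assumes "C1 S"
  shows "madj (cov_deriv A \<mu> (\<lambda>y. madj (S y)) x) = partial \<mu> S x + comm (madj (A \<mu> x)) (S x)"
  by (simp add: cov_deriv_def partial_bounded_linear[OF bounded_linear_madj assms] madj_simps
      madj_comm comm_skew[of _ "madj (A \<mu> x)"])

text \<open>Pointwise integration by parts: the product rule for the derivative,
  \<open>inner_comm\<close> for the commutator.\<close>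

lemma inner_cov_deriv:
  assumes "C1 H" "C1 S"
  shows "cov_deriv A \<mu> H x \<bullet> S x = partial \<mu> (\<lambda>y. H y \<bullet> S y) x
    - H x \<bullet> madj (cov_deriv A \<mu> (\<lambda>y. madj (S y)) x)"
  unfolding madj_cov_deriv_madj[OF assms(2)] partial_bounded_bilinear[OF bounded_bilinear_inner assms]
  by (simp add: cov_deriv_def inner_diff_left inner_add_right inner_comm)

text \<open>The fields S are arbitrary here and only once differentiable. The resulting W is then
  merely continuous, which is what the fundamental lemma asks for.\<close>

lemma weak_form_iff:
  fixes A :: "('c::finite, 'n::finite) gauge_field"
  assumes sub: "subspace \<gg>"
    and A: "\<And>\<mu>. continuous_on UNIV (A \<mu>)"
    and S: "\<And>\<mu>. C1 (S \<mu>)"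
  shows "(\<forall>H. test_field \<gg> H \<longrightarrow> (LINT x|lborel. (\<Sum>\<mu>\<in>UNIV. cov_deriv A \<mu> H x \<bullet> S \<mu> x)) = 0) \<longleftrightarrow>
    (\<forall>x. (\<Sum>\<mu>\<in>UNIV. proj \<gg> (madj (cov_deriv A \<mu> (\<lambda>y. madj (S \<mu> y)) x))) = 0)"
proof -
  define W where "W x = (\<Sum>\<mu>\<in>UNIV. madj (cov_deriv A \<mu> (\<lambda>y. madj (S \<mu> y)) x))" for x
  have contW: "continuous_on UNIV W"
    unfolding W_def madj_cov_deriv_madj[OF S]
    by (intro continuous_on_sum continuous_on_add continuous_on_partial S C1_continuous_on
        bounded_bilinear.continuous_on[OF bounded_bilinear_comm]
        bounded_linear.continuous_on[OF bounded_linear_madj] A)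
  have parts: "(LINT x|lborel. (\<Sum>\<mu>\<in>UNIV. cov_deriv A \<mu> H x \<bullet> S \<mu> x)) = - (LINT x|lborel. H x \<bullet> W x)"
    if H: "test_field \<gg> H" for H
  proof -
    note H1 = test_fieldD(1)[OF H]
    obtain a b where ab: "closure {x. H x \<noteq> 0} \<subseteq> cbox a b"
      using test_fieldD(4)[OF H] by blast
    have C1: "C1 (\<lambda>y. H y \<bullet> S \<mu> y)" for \<mu>
      by (rule C1_bounded_bilinear[OF bounded_bilinear_inner H1 S])
    have supp: "closure {x. H x \<bullet> S \<mu> x \<noteq> 0} \<subseteq> cbox a b" for \<mu>
      using closure_mono[of "{x. H x \<bullet> S \<mu> x \<noteq> 0}" "{x. H x \<noteq> 0}"] ab by force
    have bd: "bounded {x. H x \<bullet> S \<mu> x \<noteq> 0}" for \<mu>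
      by (rule bounded_subset[OF test_fieldD(3)[OF H]]) auto
    have int1: "integrable lborel (partial \<mu> (\<lambda>y. H y \<bullet> S \<mu> y))" for \<mu>
    proof (rule integrable_of_continuous[OF continuous_on_partial[OF C1]])
      show "partial \<mu> (\<lambda>y. H y \<bullet> S \<mu> y) x = 0" if "x \<notin> cbox a b" for x
        using that supp[of \<mu>] by (intro partial_outside_support) blast
    qed
    have int2: "integrable lborel (\<lambda>x. H x \<bullet> W x)"
    proof (rule integrable_of_continuous)
      show "continuous_on UNIV (\<lambda>x. H x \<bullet> W x)"
        by (intro continuous_on_inner contW C1_continuous_on H1)
      show "H x \<bullet> W x = 0" if "x \<notin> cbox a b" for x
      proof -
        have "H x = 0" using that ab closure_subset[of "{x. H x \<noteq> 0}"] by blast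
        then show ?thesis by simp
      qed
    qed
    have "(\<Sum>\<mu>\<in>UNIV. cov_deriv A \<mu> H x \<bullet> S \<mu> x) =
        (\<Sum>\<mu>\<in>UNIV. partial \<mu> (\<lambda>y. H y \<bullet> S \<mu> y) x) - H x \<bullet> W x" for x
      by (simp add: inner_cov_deriv[OF H1 S] sum_subtractf W_def inner_sum_right)
    then have "(LINT x|lborel. (\<Sum>\<mu>\<in>UNIV. cov_deriv A \<mu> H x \<bullet> S \<mu> x)) =
        (\<Sum>\<mu>\<in>UNIV. LINT x|lborel. partial \<mu> (\<lambda>y. H y \<bullet> S \<mu> y) x) - (LINT x|lborel. H x \<bullet> W x)"
      by (simp add: int1 int2)
    then show ?thesis
      by (simp add: LINT_partial_eq_0[OF C1 bd])
  qed
  have "(\<forall>H. test_field \<gg> H \<longrightarrow> (LINT x|lborel. H x \<bullet> W x) = 0) \<longleftrightarrow>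
      (\<forall>x::real^'n. \<forall>X\<in>\<gg>. X \<bullet> W x = 0)"
  proof (intro iffI allI ballI impI)
    fix x X assume *: "\<forall>H. test_field \<gg> H \<longrightarrow> (LINT x|lborel. H x \<bullet> W x) = 0" and X: "X \<in> \<gg>"
    show "X \<bullet> W x = 0"
    proof (rule continuous_eq_0_if_orthogonal_to_bumps[where w = "\<lambda>x. X \<bullet> W x"])
      show "continuous_on UNIV (\<lambda>x. X \<bullet> W x)"
        by (intro continuous_on_inner contW continuous_on_const)
      fix \<phi> :: "real^'n \<Rightarrow> real" assume "bump_class \<phi>" "bounded {x. \<phi> x \<noteq> 0}"
      from bump_test_field[OF sub X this] * show "(LINT x|lborel. \<phi> x * (X \<bullet> W x)) = 0"
        by fastforce
    qed
  next
    fix H :: "real^'n \<Rightarrow> complex^'c^'c" assume *: "\<forall>x. \<forall>X\<in>\<gg>. X \<bullet> W x = 0" and H: "test_field \<gg> H"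
    then have "H x \<bullet> W x = 0" for x using test_fieldD(2)[OF H] by blast
    then show "(LINT x|lborel. H x \<bullet> W x) = 0" by simp
  qed
  \<comment> \<open>Origin of the outer projection: W is only known to be orthogonal to
    \<open>\<gg>\<close>.\<close>
  also have "\<dots> \<longleftrightarrow> (\<forall>x. proj \<gg> (W x) = 0)"
    by (simp add: proj_eq_0_iff[OF sub])
  also have "\<dots> \<longleftrightarrow> (\<forall>x. (\<Sum>\<mu>\<in>UNIV. proj \<gg> (madj (cov_deriv A \<mu> (\<lambda>y. madj (S \<mu> y)) x))) = 0)"
    unfolding W_def
    by (simp add: linear_sum[OF bounded_linear.linear[OF bounded_linear_proj[OF sub]]])
  finally show ?thesis
    using parts by simp
qed

section \<open>Derivatives of a proto-Lagrangian\<close>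

type_synonym ('c, 'n) family = "complex^'c^'c^'n^'n"

text \<open>Matrix units placed in single slots: a complex basis of the families, matching the
  entrywise complex derivatives in \<open>mat_deriv\<close>.\<close>

definition fam_unit :: "'n \<Rightarrow> 'n \<Rightarrow> 'c \<Rightarrow> 'c \<Rightarrow> complex^'c^'c^'n^'n" where
  "fam_unit \<mu> \<nu> k l = (\<chi> \<mu>' \<nu>' k' l'. if \<mu>' = \<mu> \<and> \<nu>' = \<nu> \<and> k' = k \<and> l' = l then 1 else 0)"

lemma sum_UNIV_single:
  fixes f :: "'i::finite \<Rightarrow> 'a::comm_monoid_add"
  assumes "\<And>i. i \<noteq> a \<Longrightarrow> f i = 0"
  shows "sum f UNIV = f a"
  using sum.mono_neutral_right[of UNIV "{a}" f] assms by simp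

text \<open>Summing over l outside k agrees with the expansion of the trace of a product, so that
  the sums match term by term in the next lemma.\<close>

lemma fam_eq_sum_unit:
  "P = (\<Sum>\<mu>\<in>UNIV. \<Sum>\<nu>\<in>UNIV. \<Sum>l\<in>UNIV. \<Sum>k\<in>UNIV. fam_scale (P $ \<mu> $ \<nu> $ k $ l) (fam_unit \<mu> \<nu> k l))"
proof -
  have "(\<Sum>\<mu>\<in>UNIV. \<Sum>\<nu>\<in>UNIV. \<Sum>l\<in>UNIV. \<Sum>k\<in>UNIV.
      fam_scale (P $ \<mu> $ \<nu> $ k $ l) (fam_unit \<mu> \<nu> k l) $ \<mu>' $ \<nu>' $ k' $ l') = P $ \<mu>' $ \<nu>' $ k' $ l'"
    for \<mu>' \<nu>' k' l'
    by (subst sum_UNIV_single[of \<mu>'], simp add: fam_scale_def fam_unit_def)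
       (subst sum_UNIV_single[of \<nu>'], simp add: fam_scale_def fam_unit_def,
        subst sum_UNIV_single[of l'], simp add: fam_scale_def fam_unit_def,
        subst sum_UNIV_single[of k'], simp_all add: fam_scale_def fam_unit_def)
  then show ?thesis
    by (simp add: vec_eq_iff sum_component)
qed

lemma linear_fam_eq_sum_trace:
  fixes L :: "('c::finite, 'n::{finite,linorder}) family \<Rightarrow> complex"
  assumes lin: "linear L" and scale: "\<And>z H. L (fam_scale z H) = z * L H"
    and indep: "\<And>\<mu> \<nu> k l. \<not> \<mu> < \<nu> \<Longrightarrow> L (fam_unit \<mu> \<nu> k l) = 0"
  shows "L H = (\<Sum>\<mu>\<in>UNIV. \<Sum>\<nu>\<in>UNIV. if \<mu> < \<nu>
    then trace ((\<chi> l k. L (fam_unit \<mu> \<nu> k l)) ** H $ \<mu> $ \<nu>) else 0)"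
proof -
  have "L H = (\<Sum>\<mu>\<in>UNIV. \<Sum>\<nu>\<in>UNIV. \<Sum>l\<in>UNIV. \<Sum>k\<in>UNIV. H $ \<mu> $ \<nu> $ k $ l * L (fam_unit \<mu> \<nu> k l))"
    by (subst fam_eq_sum_unit[of H]) (simp only: linear_sum[OF lin] scale)
  also have "\<dots> = (\<Sum>\<mu>\<in>UNIV. \<Sum>\<nu>\<in>UNIV. if \<mu> < \<nu>
    then trace ((\<chi> l k. L (fam_unit \<mu> \<nu> k l)) ** H $ \<mu> $ \<nu>) else 0)"
    by (intro sum.cong refl) (auto simp: indep trace_def matrix_matrix_mult_def mult.commute)
  finally show ?thesis .
qed

lemma bounded_linear_fam_madj: "bounded_linear (fam_madj :: complex^'c^'c^'n^'n \<Rightarrow> _)"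
  by (simp add: linear_conv_bounded_linear[symmetric] linear_iff fam_madj_def vec_eq_iff madj_simps)

section \<open>The derivative in the matrix arguments\<close>

context
  fixes \<gg> :: "(complex^'c::finite^'c) set"
    and \<G> :: "('c, 'n::{finite,linorder}) proto"
  assumes proto: "gauge_proto_lagrangian \<gg> \<G>"
begin

abbreviation joint :: "('c, 'n) family \<times> ('c, 'n) family \<times> (real, 'n) vec \<Rightarrow> complex" where
  "joint \<equiv> \<lambda>(P, Q, x). \<G> P Q x"

text \<open>A derivative of the joint map in directions that leave x fixed: joint smoothness then
  gives regularity in the matrices and in x together.\<close>

abbreviation DG where
  "DG P Q x H K \<equiv> frechet_derivative joint (at (P, Q, x)) (H, K, 0)"

lemma smooth_joint: "smooth joint"
  using proto unfolding gauge_proto_lagrangian_def by blast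

lemmas C1_joint = smooth_imp_C1[OF smooth_joint]

lemma linear_DG: "linear (\<lambda>(H, K). DG P Q x H K)"
proof -
  have "linear (\<lambda>v. frechet_derivative joint (at (P, Q, x)) ((\<lambda>(H, K). (H, K, 0)) v))"
    by (rule linear_compose[OF _ has_derivative_linear[OF C1_has_derivative[OF C1_joint]], unfolded o_def])
       (auto simp: linear_iff)
  then show ?thesis by (simp add: split_beta')
qed

lemma DG_add: "DG P Q x (H + H') (K + K') = DG P Q x H K + DG P Q x H' K'"
  using linear_add[OF linear_DG, of P Q x "(H, K)" "(H', K')"] by simp

lemma linear_DG_P: "linear (\<lambda>H. DG P Q x H 0)"
  using linear_compose[OF _ linear_DG, of "\<lambda>H. (H, 0)" P Q x] by (simp add: linear_iff o_def)

lemma linear_DG_Q: "linear (\<lambda>K. DG P Q x 0 K)"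
  using linear_compose[OF _ linear_DG, of "\<lambda>K. (0, K)" P Q x] by (simp add: linear_iff o_def)

lemma DG_curve:
  assumes "(p has_vector_derivative H) (at t)" "(q has_vector_derivative K) (at t)"
  shows "((\<lambda>s. \<G> (p s) (q s) x) has_vector_derivative DG (p t) (q t) x H K) (at t)"
proof -
  have "((\<lambda>s. (p s, q s, x)) has_derivative (\<lambda>s. s *\<^sub>R (H, K, 0))) (at t)"
    using assms unfolding has_vector_derivative_def
    by (auto intro!: derivative_eq_intros)
  from diff_chain_at[OF this C1_has_derivative[OF C1_joint]] show ?thesis
    by (simp add: has_vector_derivative_def o_def
        linear_scale[OF has_derivative_linear[OF C1_has_derivative[OF C1_joint]]] del: scaleR_Pair)
qed

text \<open>Smoothness provides the joint real derivative, analyticity a complex linear one in the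
  matrices at fixed x; uniqueness of derivatives identifies them.\<close>

lemma DG_scale: "DG P Q x (fam_scale z H) (fam_scale z K) = z * DG P Q x H K"
proof -
  obtain D where D: "((\<lambda>(P, Q). \<G> P Q x) has_derivative D) (at (P, Q))"
    "\<And>z H K. D (fam_scale z H, fam_scale z K) = z * D (H, K)"
    using proto unfolding gauge_proto_lagrangian_def analytic_in_matrices_def by blast
  have "((\<lambda>v. (fst v, snd v, x)) has_derivative (\<lambda>v. (fst v, snd v, 0))) (at (P, Q))"
    by (auto intro!: derivative_eq_intros)
  from diff_chain_at[OF this C1_has_derivative[OF C1_joint]]
  have "((\<lambda>(P, Q). \<G> P Q x) has_derivative (\<lambda>(H, K). DG P Q x H K)) (at (P, Q))"
    by (simp add: o_def split_beta')
  with D(1) have "D = (\<lambda>(H, K). DG P Q x H K)"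
    using has_derivative_unique by blast
  then show ?thesis using D(2)[of z H K] by simp
qed

lemma fam_scale_zero: "fam_scale z 0 = 0"
  by (simp add: fam_scale_def vec_eq_iff)

text \<open>The proto-Lagrangian is constant along lines in the slots that it ignores.\<close>

lemma DG_unit_eq_0:
  assumes "\<not> \<mu> < \<nu>"
  shows "DG P Q x (fam_unit \<mu> \<nu> k l) 0 = 0" "DG P Q x 0 (fam_unit \<mu> \<nu> k l) = 0"
proof -
  have ind: "\<G> P Q x = \<G> P' Q' x"
    if "\<forall>\<mu> \<nu>. \<mu> < \<nu> \<longrightarrow> P $ \<mu> $ \<nu> = P' $ \<mu> $ \<nu> \<and> Q $ \<mu> $ \<nu> = Q' $ \<mu> $ \<nu>" for P P' Q Q'
    using proto that unfolding gauge_proto_lagrangian_def by blast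
  have 0: "fam_unit \<mu> \<nu> k l $ \<mu>' $ \<nu>' = 0" if "\<mu>' < \<nu>'" for \<mu>' \<nu>'
    using that assms by (auto simp: fam_unit_def vec_eq_iff)
  have lin: "((\<lambda>s. R + s *\<^sub>R V) has_vector_derivative V) (at 0)"
    for R V :: "('c, 'n) family"
    by (auto intro!: derivative_eq_intros)
  have "\<G> (P + s *\<^sub>R fam_unit \<mu> \<nu> k l) Q x = \<G> P Q x"
    "\<G> P (Q + s *\<^sub>R fam_unit \<mu> \<nu> k l) x = \<G> P Q x" for s
    by (rule ind, simp add: 0)+
  then show "DG P Q x (fam_unit \<mu> \<nu> k l) 0 = 0" "DG P Q x 0 (fam_unit \<mu> \<nu> k l) = 0"
    using DG_curve[OF lin[of P "fam_unit \<mu> \<nu> k l"] has_vector_derivative_const[of Q], of x]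
      DG_curve[OF has_vector_derivative_const[of P] lin[of Q "fam_unit \<mu> \<nu> k l"], of x]
      vector_derivative_unique_at[OF _ has_vector_derivative_const] by auto
qed

lemma fam_upd_entry:
  "fam_upd P \<mu> \<nu> (\<chi> k' l'. if k' = k \<and> l' = l then z else P $ \<mu> $ \<nu> $ k' $ l') =
    P + fam_scale (z - P $ \<mu> $ \<nu> $ k $ l) (fam_unit \<mu> \<nu> k l)"
  by (auto simp: vec_eq_iff fam_upd_def fam_scale_def fam_unit_def)

text \<open>The chain rule gives a real derivative in z, which \<open>DG_scale\<close> shows to be
  multiplication by a complex number. H = 0 or K = 0 yields the two kinds of entry
  derivatives.\<close>

lemma entry_deriv:
  "((\<lambda>z. \<G> (P + fam_scale (z - z0) H) (Q + fam_scale (z - z0) K) x)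
    has_field_derivative DG P Q x H K) (at z0)"
proof -
  have lin: "bounded_linear (\<lambda>z. fam_scale z H)" for H :: "('c, 'n) family"
    by (simp add: linear_conv_bounded_linear[symmetric] linear_iff fam_scale_def vec_eq_iff algebra_simps)
  have "((\<lambda>z. fam_scale (z - z0) H) has_derivative (\<lambda>z. fam_scale z H)) (at z0)"
    for H :: "('c, 'n) family"
    by (rule bounded_linear.has_derivative[OF lin]) (auto intro!: derivative_eq_intros)
  then have "((\<lambda>z. (P + fam_scale (z - z0) H, Q + fam_scale (z - z0) K, x)) has_derivative
      (\<lambda>z. (fam_scale z H, fam_scale z K, 0))) (at z0)"
    by (auto intro!: derivative_eq_intros)
  from diff_chain_at[OF this C1_has_derivative[OF C1_joint]]
  have "((\<lambda>z. \<G> (P + fam_scale (z - z0) H) (Q + fam_scale (z - z0) K) x) has_derivative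
      (\<lambda>z. DG (P + fam_scale 0 H) (Q + fam_scale 0 K) x (fam_scale z H) (fam_scale z K))) (at z0)"
    by (simp add: o_def)
  moreover have "fam_scale 0 H = 0" for H :: "('c, 'n) family"
    by (simp add: fam_scale_def vec_eq_iff)
  ultimately show ?thesis
    by (simp add: has_field_derivative_def DG_scale mult_commute_abs)
qed

lemma mat_deriv_P:
  "mat_deriv (\<lambda>Z. \<G> (fam_upd P \<mu> \<nu> Z) Q x) (P $ \<mu> $ \<nu>) = (\<chi> l k. DG P Q x (fam_unit \<mu> \<nu> k l) 0)"
  using entry_deriv[of P _ _ Q 0 x, THEN DERIV_imp_deriv]
  by (simp add: mat_deriv_def fam_upd_entry fam_scale_zero)

lemma mat_deriv_Q:
  "mat_deriv (\<lambda>Z. \<G> P (fam_upd Q \<mu> \<nu> Z) x) (Q $ \<mu> $ \<nu>) = (\<chi> l k. DG P Q x 0 (fam_unit \<mu> \<nu> k l))"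
  using entry_deriv[of P _ 0 Q _ x, THEN DERIV_imp_deriv]
  by (simp add: mat_deriv_def fam_upd_entry fam_scale_zero)

lemma deriv_P_eq: "deriv_P \<G> A \<mu> \<nu> x =
    (\<chi> l k. DG (field_strength A x) (fam_madj (field_strength A x)) x (fam_unit \<mu> \<nu> k l) 0)"
  by (simp add: deriv_P_def Let_def mat_deriv_P)

lemma deriv_Q_eq: "deriv_Q \<G> A \<mu> \<nu> x =
    (\<chi> l k. DG (field_strength A x) (fam_madj (field_strength A x)) x 0 (fam_unit \<mu> \<nu> k l))"
  unfolding deriv_Q_def Let_def by (rule mat_deriv_Q)

lemma DG_P_eq_sum_trace:
  "DG (field_strength A x) (fam_madj (field_strength A x)) x H 0 =
    (\<Sum>\<mu>\<in>UNIV. \<Sum>\<nu>\<in>UNIV. if \<mu> < \<nu> then trace (deriv_P \<G> A \<mu> \<nu> x ** H $ \<mu> $ \<nu>) else 0)"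
  unfolding deriv_P_eq
  by (rule linear_fam_eq_sum_trace[OF linear_DG_P])
     (use DG_scale[of _ _ _ _ _ 0] DG_unit_eq_0 in \<open>simp_all add: fam_scale_zero\<close>)

lemma DG_Q_eq_sum_trace:
  "DG (field_strength A x) (fam_madj (field_strength A x)) x 0 K =
    (\<Sum>\<mu>\<in>UNIV. \<Sum>\<nu>\<in>UNIV. if \<mu> < \<nu> then trace (deriv_Q \<G> A \<mu> \<nu> x ** K $ \<mu> $ \<nu>) else 0)"
  unfolding deriv_Q_eq
  by (rule linear_fam_eq_sum_trace[OF linear_DG_Q])
     (use DG_scale[of _ _ _ _ 0] DG_unit_eq_0 in \<open>simp_all add: fam_scale_zero\<close>)

text \<open>Polarized reality for the pair P, P + s B is differentiated at s = 0. Since s is real,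
  conjugation commutes with the derivative.\<close>

lemma DG_polarized:
  assumes "polarized_reality \<gg> \<G>" "subspace \<gg>" "fam_in \<gg> P" "fam_in \<gg> B"
  shows "DG P (fam_madj P) x B 0 = cnj (DG P (fam_madj P) x 0 (fam_madj B))"
proof -
  have "((\<lambda>s. P + s *\<^sub>R B) has_vector_derivative B) (at 0)"
    by (auto intro!: derivative_eq_intros)
  note c = this bounded_linear.has_vector_derivative[OF bounded_linear_fam_madj this]
  have eq: "(\<lambda>s::real. \<G> (P + s *\<^sub>R B) (fam_madj P) x) = (\<lambda>s. cnj (\<G> P (fam_madj (P + s *\<^sub>R B)) x))"
  proof
    fix s :: real
    have "fam_in \<gg> (P + s *\<^sub>R B)"
      using assms by (simp add: fam_in_def subspace_add subspace_scale)
    with assms show "\<G> (P + s *\<^sub>R B) (fam_madj P) x = cnj (\<G> P (fam_madj (P + s *\<^sub>R B)) x)"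
      unfolding polarized_reality_def by blast
  qed
  have "((\<lambda>s. \<G> (P + s *\<^sub>R B) (fam_madj P) x) has_vector_derivative DG P (fam_madj P) x B 0) (at 0)"
    using DG_curve[OF c(1) has_vector_derivative_const, of "fam_madj P" x] by simp
  moreover have "((\<lambda>s. cnj (\<G> P (fam_madj (P + s *\<^sub>R B)) x)) has_vector_derivative
      cnj (DG P (fam_madj P) x 0 (fam_madj B))) (at 0)"
    using has_vector_derivative_cnj[OF DG_curve[OF has_vector_derivative_const c(2), of P x]] by simp
  ultimately show ?thesis
    unfolding eq by (rule vector_derivative_unique_at)
qed

end

section \<open>The first variation\<close>

text \<open>The covariant exterior derivative of the one-form with the single component H in
  position \<open>\<kappa>\<close>, i.e. the linearized curvature.\<close>

definition variation :: "('c::finite, 'n::finite) gauge_field \<Rightarrow> 'n \<Rightarrow> (real^'n \<Rightarrow> complex^'c^'c)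
    \<Rightarrow> real^'n \<Rightarrow> complex^'c^'c^'n^'n" where
  "variation A \<kappa> H x = (\<chi> \<mu> \<nu>. (if \<nu> = \<kappa> then cov_deriv A \<mu> H x else 0)
    - (if \<mu> = \<kappa> then cov_deriv A \<nu> H x else 0))"

text \<open>The field strength is quadratic in \<open>A\<close>, but it is affine in the single component
  \<open>A\<^sub>\<kappa>\<close> because \<open>[H, H] = 0\<close>.\<close>

lemma field_strength_variation:
  assumes A: "\<And>\<mu>. C1 (A \<mu>)" and H: "C1 H"
  shows "field_strength (A(\<kappa> := \<lambda>y. A \<kappa> y + \<epsilon> *\<^sub>R H y)) x = field_strength A x + \<epsilon> *\<^sub>R variation A \<kappa> H x"
proof -
  let ?A = "A(\<kappa> := \<lambda>y. A \<kappa> y + \<epsilon> *\<^sub>R H y)"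
  have partial: "partial \<mu> (?A \<nu>) x = partial \<mu> (A \<nu>) x + (if \<nu> = \<kappa> then \<epsilon> *\<^sub>R partial \<mu> H x else 0)" for \<mu> \<nu>
  proof -
    have "((\<lambda>y. A \<kappa> y + \<epsilon> *\<^sub>R H y) has_derivative
        (\<lambda>v. frechet_derivative (A \<kappa>) (at x) v + \<epsilon> *\<^sub>R frechet_derivative H (at x) v)) (at x)"
      by (intro has_derivative_add has_derivative_scaleR_right C1_has_derivative A H)
    from partial_eqI[OF this, of \<mu>] show ?thesis
      by (auto simp: partial_def[of _ "A \<kappa>"] partial_def[of _ H])
  qed
  have val: "?A \<mu> x = A \<mu> x + (if \<mu> = \<kappa> then \<epsilon> *\<^sub>R H x else 0)" for \<mu>
    by simp
  have "partial \<mu> (?A \<nu>) x - partial \<nu> (?A \<mu>) x - comm (?A \<mu> x) (?A \<nu> x) =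
      (partial \<mu> (A \<nu>) x - partial \<nu> (A \<mu>) x - comm (A \<mu> x) (A \<nu> x)) +
      \<epsilon> *\<^sub>R ((if \<nu> = \<kappa> then cov_deriv A \<mu> H x else 0) - (if \<mu> = \<kappa> then cov_deriv A \<nu> H x else 0))" for \<mu> \<nu>
    unfolding partial val
    by (auto simp: cov_deriv_def comm_def matrix_mult_linear matrix_mult_scaleR algebra_simps)
  then show ?thesis
    by (simp add: vec_eq_iff field_strength_def variation_def)
qed

lemma continuous_on_cov_deriv:
  "continuous_on UNIV (A \<mu>) \<Longrightarrow> C1 H \<Longrightarrow> continuous_on UNIV (cov_deriv A \<mu> H)"
  unfolding cov_deriv_def[abs_def]
  by (intro continuous_on_diff continuous_on_partial
      bounded_bilinear.continuous_on[OF bounded_bilinear_comm _ C1_continuous_on])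

lemma continuous_on_variation:
  assumes "\<And>\<mu>. C1 (A \<mu>)" "C1 H"
  shows "continuous_on UNIV (variation A \<kappa> H)"
proof -
  have "continuous_on UNIV (\<lambda>x. if b then cov_deriv A \<mu> H x else 0)" for b \<mu>
    using continuous_on_cov_deriv[OF C1_continuous_on[OF assms(1)] assms(2)] by (cases b) auto
  then show ?thesis
    unfolding variation_def[abs_def] by (intro continuous_on_vec_lambda continuous_on_diff)
qed

lemma variation_outside_support:
  assumes "x \<notin> closure {y. H y \<noteq> 0}"
  shows "variation A \<kappa> H x = 0"
proof -
  have "H x = 0" using assms closure_subset[of "{y. H y \<noteq> 0}"] by blast
  then have "cov_deriv A \<mu> H x = 0" for \<mu>
    by (simp add: cov_deriv_def partial_outside_support[OF assms] comm_def)
  then show ?thesis by (simp add: variation_def vec_eq_iff)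
qed

lemma C1_field_strength:
  assumes "\<And>\<mu>. smooth (A \<mu>)"
  shows "C1 (field_strength A)"
  unfolding field_strength_def[abs_def]
  by (intro C1_vec_lambda C1_diff C1_partial C1_bounded_bilinear[OF bounded_bilinear_comm]
      smooth_imp_C1 assms)

context
  fixes \<gg> :: "(complex^'c::finite^'c) set"
    and \<G> :: "('c, 'n::{finite,linorder}) proto"
    and A :: "('c, 'n) gauge_field"
  assumes lie: "matrix_lie_algebra \<gg>"
    and proto: "gauge_proto_lagrangian \<gg> \<G>"
    and real: "polarized_reality \<gg> \<G>"
    and field: "is_gauge_field \<gg> A"
begin

lemma subspace_lie: "subspace \<gg>"
  using lie by (simp add: matrix_lie_algebra_def)

lemma smooth_A: "smooth (A \<mu>)" and A_in: "A \<mu> x \<in> \<gg>"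
  using field by (auto simp: is_gauge_field_def)

lemmas C1_A = smooth_imp_C1[OF smooth_A]

lemma field_strength_in: "field_strength A x $ \<mu> $ \<nu> \<in> \<gg>"
proof -
  have "partial \<mu> (A \<nu>) x \<in> \<gg>" for \<mu> \<nu>
    unfolding partial_def using field C1_A
    by (intro frechet_derivative_in_subspace subspace_lie) (auto simp: is_gauge_field_def C1_def)
  then show ?thesis
    using lie A_in by (auto simp: field_strength_def matrix_lie_algebra_def intro!: subspace_diff subspace_lie)
qed

lemma variation_in:
  assumes "test_field \<gg> H"
  shows "variation A \<kappa> H x $ \<mu> $ \<nu> \<in> \<gg>"
  using cov_deriv_in[where A = A, OF lie A_in test_fieldD(1)[OF assms]] test_fieldD(2)[OF assms] subspace_0[OF subspace_lie]
  by (auto simp: variation_def intro!: subspace_diff subspace_neg subspace_lie)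

text \<open>A directional derivative of the smooth joint map is again smooth and is composed with a
  \<open>C1\<close> map of x. Integration by parts will differentiate the result.\<close>

lemma C1_Ghat_star: "C1 (Ghat_star \<G> A \<mu> \<nu>)"
proof -
  have F: "C1 (\<lambda>x. (field_strength A x, fam_madj (field_strength A x), x))"
    by (intro C1_Pair C1_bounded_linear[OF bounded_linear_fam_madj] C1_field_strength C1_ident smooth_A)
  have D: "C1 (deriv_Q \<G> A \<mu> \<nu>)" for \<mu> \<nu>
    unfolding deriv_Q_eq[OF proto, abs_def]
    by (intro C1_vec_lambda C1_compose[OF _ F]
        smooth_imp_C1[OF smooth_frechet_derivative[OF smooth_joint[OF proto]]])
  show ?thesis
    unfolding antisym_ext_def[abs_def]
    by (cases \<mu> \<nu> rule: linorder_cases) (auto simp: D C1_uminus[OF D] C1_const less_not_sym order_less_imp_not_eq2)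
qed

text \<open>The two halves of the derivative are z and its conjugate, which explains both the factor
  2 and the absence of P-derivatives.\<close>

lemma DG_variation:
  assumes H: "test_field \<gg> H"
  shows "DG \<G> (field_strength A x) (fam_madj (field_strength A x)) x
      (variation A \<kappa> H x) (fam_madj (variation A \<kappa> H x)) =
    of_real (2 * (\<Sum>\<mu>\<in>UNIV. cov_deriv A \<mu> H x \<bullet> proj \<gg> (Ghat_star \<G> A \<mu> \<kappa> x)))"
proof -
  let ?F = "field_strength A x" and ?B = "variation A \<kappa> H x"
  let ?c = "\<lambda>\<mu>. cov_deriv A \<mu> H x"
  define z where "z = DG \<G> ?F (fam_madj ?F) x 0 (fam_madj ?B)"
  have "DG \<G> ?F (fam_madj ?F) x ?B (fam_madj ?B) = DG \<G> ?F (fam_madj ?F) x ?B 0 + z"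
    using DG_add[OF proto, of ?F "fam_madj ?F" x ?B 0 0 "fam_madj ?B"]
    by (simp only: z_def add_0_left add_0_right)
  also have "DG \<G> ?F (fam_madj ?F) x ?B 0 = cnj z"
    unfolding z_def
    by (rule DG_polarized[OF proto real subspace_lie]) (auto simp: fam_in_def field_strength_in variation_in[OF H])
  finally have "DG \<G> ?F (fam_madj ?F) x ?B (fam_madj ?B) = of_real (2 * Re z)"
    by (simp add: complex_eq_iff)
  moreover have "Re z = (\<Sum>\<mu>\<in>UNIV. ?c \<mu> \<bullet> proj \<gg> (Ghat_star \<G> A \<mu> \<kappa> x))"
  proof -
    have tr: "Re (trace (X ** madj Y)) = Y \<bullet> X" for X Y :: "complex^'c^'c"
      by (simp add: inner_eq_Re_trace trace_mul_sym[of X])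
    have "Re z = (\<Sum>\<mu>\<in>UNIV. \<Sum>\<nu>\<in>UNIV. if \<mu> < \<nu> then ?B $ \<mu> $ \<nu> \<bullet> deriv_Q \<G> A \<mu> \<nu> x else 0)"
      unfolding z_def DG_Q_eq_sum_trace[OF proto]
      by (simp add: fam_madj_def tr if_distrib[of Re] cong: if_cong)
    also have "\<dots> = (\<Sum>\<mu>\<in>UNIV. \<Sum>\<nu>\<in>UNIV.
        (if \<nu> = \<kappa> then if \<mu> < \<kappa> then ?c \<mu> \<bullet> deriv_Q \<G> A \<mu> \<kappa> x else 0 else 0)
        - (if \<mu> = \<kappa> then if \<kappa> < \<nu> then ?c \<nu> \<bullet> deriv_Q \<G> A \<kappa> \<nu> x else 0 else 0))"
      by (intro sum.cong refl) (auto simp: variation_def inner_diff_left)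
    also have "\<dots> = (\<Sum>\<mu>\<in>UNIV. if \<mu> < \<kappa> then ?c \<mu> \<bullet> deriv_Q \<G> A \<mu> \<kappa> x else 0)
        - (\<Sum>\<nu>\<in>UNIV. if \<kappa> < \<nu> then ?c \<nu> \<bullet> deriv_Q \<G> A \<kappa> \<nu> x else 0)"
      unfolding sum_subtractf
      by (subst (2) sum.swap) simp
    \<comment> \<open>The sums over indices below and above \<open>\<kappa>\<close> carry opposite
      signs, exactly as in the antisymmetric extension; \<open>\<kappa>\<close> itself contributes
      0.\<close>
    also have "\<dots> = (\<Sum>\<mu>\<in>UNIV. ?c \<mu> \<bullet> Ghat_star \<G> A \<mu> \<kappa> x)"
      unfolding sum_subtractf[symmetric]
      by (intro sum.cong refl) (auto simp: antisym_ext_def)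
    \<comment> \<open>The covariant derivative of H lies in \<open>\<gg>\<close>, so only the
      projected part is seen.\<close>
    also have "\<dots> = (\<Sum>\<mu>\<in>UNIV. ?c \<mu> \<bullet> proj \<gg> (Ghat_star \<G> A \<mu> \<kappa> x))"
      using cov_deriv_in[where A = A, OF lie A_in test_fieldD(1)[OF H]] test_fieldD(2)[OF H]
      by (intro sum.cong refl) (simp add: inner_proj[OF subspace_lie] image_subset_iff)
    finally show ?thesis .
  qed
  ultimately show ?thesis by simp
qed

lemma action_has_vector_derivative:
  assumes H: "test_field \<gg> H"
  shows "((\<lambda>\<epsilon>. LINT x|lborel. lagrangian \<G> (A(\<kappa> := \<lambda>y. A \<kappa> y + \<epsilon> *\<^sub>R H y)) x - lagrangian \<G> A x)
      has_vector_derivative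
      of_real (2 * (LINT x|lborel. (\<Sum>\<mu>\<in>UNIV. cov_deriv A \<mu> H x \<bullet> proj \<gg> (Ghat_star \<G> A \<mu> \<kappa> x))))) (at 0)"
proof -
  note H1 = test_fieldD(1)[OF H]
  obtain a b where ab: "closure {x. H x \<noteq> 0} \<subseteq> cbox a b"
    using test_fieldD(4)[OF H] by blast
  let ?F = "field_strength A" and ?B = "variation A \<kappa> H"
  let ?P = "\<lambda>\<epsilon> x. ?F x + \<epsilon> *\<^sub>R ?B x"
  note contF = C1_continuous_on[OF C1_field_strength[where A = A, OF smooth_A]]
  note contB = continuous_on_variation[where A = A, OF C1_A H1]
  have lagr: "lagrangian \<G> (A(\<kappa> := \<lambda>y. A \<kappa> y + \<epsilon> *\<^sub>R H y)) x = \<G> (?P \<epsilon> x) (fam_madj (?P \<epsilon> x)) x" for \<epsilon> x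
    by (simp add: lagrangian_def field_strength_variation[where A = A, OF C1_A H1])
  have cP: "continuous_on UNIV (\<lambda>y. ?P (fst y) (snd y))"
    by (intro continuous_on_add continuous_on_scaleR continuous_on_compose2[OF contF]
        continuous_on_compose2[OF contB] continuous_on_fst continuous_on_snd continuous_on_id) auto
  have cB: "continuous_on UNIV (\<lambda>y::real \<times> (real, 'n) vec. ?B (snd y))"
    by (intro continuous_on_compose2[OF contB] continuous_on_snd continuous_on_id) auto
  have "((\<lambda>\<epsilon>. LINT x|lborel. \<G> (?P \<epsilon> x) (fam_madj (?P \<epsilon> x)) x - lagrangian \<G> A x) has_vector_derivative
      (LINT x|lborel. DG \<G> (?P 0 x) (fam_madj (?P 0 x)) x (?B x) (fam_madj (?B x)))) (at 0)"
  proof (rule LINT_has_vector_derivative)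
    fix \<epsilon> :: real and x :: "(real, 'n) vec"
    have p: "((\<lambda>\<epsilon>. ?P \<epsilon> x) has_vector_derivative ?B x) (at \<epsilon>)"
      by (auto intro!: derivative_eq_intros)
    show "((\<lambda>\<epsilon>. \<G> (?P \<epsilon> x) (fam_madj (?P \<epsilon> x)) x - lagrangian \<G> A x) has_vector_derivative
        DG \<G> (?P \<epsilon> x) (fam_madj (?P \<epsilon> x)) x (?B x) (fam_madj (?B x))) (at \<epsilon>)"
      using has_vector_derivative_diff[OF DG_curve[OF proto p
            bounded_linear.has_vector_derivative[OF bounded_linear_fam_madj p]] has_vector_derivative_const]
      by simp
  next
    have "continuous_on UNIV (\<lambda>y. DG \<G> (?P (fst y) (snd y)) (fam_madj (?P (fst y) (snd y))) (snd y)
        (?B (snd y)) (fam_madj (?B (snd y))))"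
      by (intro C1_continuous_derivative_joint[OF C1_joint[OF proto]] continuous_on_Pair cP cB
          bounded_linear.continuous_on[OF bounded_linear_fam_madj] continuous_on_snd continuous_on_id
          continuous_on_const)
    then show "continuous_on UNIV (\<lambda>(\<epsilon>, x). DG \<G> (?P \<epsilon> x) (fam_madj (?P \<epsilon> x)) x (?B x) (fam_madj (?B x)))"
      by (simp add: split_beta')
  next
    fix \<epsilon> :: real
    \<comment> \<open>Shown for every \<open>\<epsilon>\<close>, since the value 0 covers the
      unperturbed Lagrangian.\<close>
    have c: "continuous_on UNIV (\<lambda>x. \<G> (?P \<epsilon> x) (fam_madj (?P \<epsilon> x)) x)" for \<epsilon> :: real
    proof -
      have "continuous_on UNIV (\<lambda>x. (?P \<epsilon> x, fam_madj (?P \<epsilon> x), x))"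
        by (intro continuous_on_Pair continuous_on_add continuous_on_scaleR contF contB
            bounded_linear.continuous_on[OF bounded_linear_fam_madj] continuous_on_id continuous_on_const)
      from continuous_on_compose2[OF C1_continuous_on[OF C1_joint[OF proto], of UNIV] this]
      show ?thesis by simp
    qed
    show "continuous_on UNIV (\<lambda>x. \<G> (?P \<epsilon> x) (fam_madj (?P \<epsilon> x)) x - lagrangian \<G> A x)"
      using continuous_on_diff[OF c[of \<epsilon>] c[of 0]] by (simp add: lagrangian_def)
  next
    fix \<epsilon> :: real and x :: "(real, 'n) vec"
    assume "x \<notin> cbox a b"
    then have "?B x = 0" using ab by (intro variation_outside_support) blast
    then show "\<G> (?P \<epsilon> x) (fam_madj (?P \<epsilon> x)) x - lagrangian \<G> A x = 0"
      by (simp add: lagrangian_def)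
  qed
  then show ?thesis
    unfolding lagr by (simp add: DG_variation[OF H] del: of_real_mult of_real_sum)
qed

text \<open>Uniqueness of the derivative turns stationarity into the vanishing of the first
  variation; \<open>weak_form_iff\<close> then applies with the projected starred derivative as
  S.\<close>

lemma euler_lagrange_iff_star:
  "euler_lagrange \<gg> \<G> A \<longleftrightarrow>
    (\<forall>\<kappa> x. (\<Sum>\<mu>\<in>UNIV. proj \<gg> (madj (cov_deriv A \<mu> (\<lambda>y. madj (proj \<gg> (Ghat_star \<G> A \<mu> \<kappa> y))) x))) = 0)"
proof -
  have "euler_lagrange \<gg> \<G> A \<longleftrightarrow> (\<forall>\<kappa> H. test_field \<gg> H \<longrightarrow>
      (LINT x|lborel. (\<Sum>\<mu>\<in>UNIV. cov_deriv A \<mu> H x \<bullet> proj \<gg> (Ghat_star \<G> A \<mu> \<kappa> x))) = 0)"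
    (is "_ \<longleftrightarrow> (\<forall>\<kappa> H. _ \<longrightarrow> ?I \<kappa> H = 0)")
  proof -
    have "((\<lambda>\<epsilon>. LINT x|lborel. lagrangian \<G> (A(\<kappa> := \<lambda>y. A \<kappa> y + \<epsilon> *\<^sub>R H y)) x - lagrangian \<G> A x)
        has_vector_derivative 0) (at 0) \<longleftrightarrow> ?I \<kappa> H = 0" if "test_field \<gg> H" for \<kappa> H
      using action_has_vector_derivative[OF that, of \<kappa>] vector_derivative_unique_at by fastforce
    then show ?thesis
      unfolding euler_lagrange_def by blast
  qed
  also have "\<dots> \<longleftrightarrow> (\<forall>\<kappa> x. (\<Sum>\<mu>\<in>UNIV. proj \<gg> (madj (cov_deriv A \<mu> (\<lambda>y. madj (proj \<gg> (Ghat_star \<G> A \<mu> \<kappa> y))) x))) = 0)"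
    by (intro all_cong1 weak_form_iff subspace_lie C1_continuous_on C1_A
        C1_bounded_linear[OF bounded_linear_proj[OF subspace_lie] C1_Ghat_star])
  finally show ?thesis .
qed

text \<open>Comparing the two halves of the polarized first variation at a family with the single
  member \<open>X\<close>.\<close>

lemma inner_deriv_Q:
  assumes "X \<in> \<gg>" "\<mu> < \<nu>"
  shows "X \<bullet> deriv_Q \<G> A \<mu> \<nu> x = madj X \<bullet> deriv_P \<G> A \<mu> \<nu> x"
proof -
  define B where "B = fam_upd 0 \<mu> \<nu> X"
  have B0: "B $ \<mu>' $ \<nu>' = 0" "fam_madj B $ \<mu>' $ \<nu>' = 0" if "(\<mu>', \<nu>') \<noteq> (\<mu>, \<nu>)" for \<mu>' \<nu>'
    using that by (auto simp: B_def fam_upd_def fam_madj_def madj_simps)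
  have single: "(\<Sum>\<mu>'\<in>UNIV. \<Sum>\<nu>'\<in>UNIV. if \<mu>' < \<nu>' then trace (D \<mu>' \<nu>' ** C $ \<mu>' $ \<nu>') else 0) =
      trace (D \<mu> \<nu> ** C $ \<mu> $ \<nu>)"
    if C: "\<And>\<mu>' \<nu>'. (\<mu>', \<nu>') \<noteq> (\<mu>, \<nu>) \<Longrightarrow> C $ \<mu>' $ \<nu>' = 0"
    for D :: "'n \<Rightarrow> 'n \<Rightarrow> complex^'c^'c" and C :: "('c, 'n) family"
  proof -
    have 0: "(if \<mu>' < \<nu>' then trace (D \<mu>' \<nu>' ** C $ \<mu>' $ \<nu>') else 0) = 0" if "(\<mu>', \<nu>') \<noteq> (\<mu>, \<nu>)" for \<mu>' \<nu>'
      by (simp add: C[OF that] trace_def)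
    have "(\<Sum>\<mu>'\<in>UNIV. \<Sum>\<nu>'\<in>UNIV. if \<mu>' < \<nu>' then trace (D \<mu>' \<nu>' ** C $ \<mu>' $ \<nu>') else 0) =
        (\<Sum>\<nu>'\<in>UNIV. if \<mu> < \<nu>' then trace (D \<mu> \<nu>' ** C $ \<mu> $ \<nu>') else 0)"
      by (rule sum_UNIV_single) (intro sum.neutral ballI 0, simp)
    also have "\<dots> = (if \<mu> < \<nu> then trace (D \<mu> \<nu> ** C $ \<mu> $ \<nu>) else 0)"
      by (rule sum_UNIV_single) (rule 0, simp)
    finally show ?thesis using assms(2) by simp
  qed
  have "DG \<G> (field_strength A x) (fam_madj (field_strength A x)) x B 0 =
      cnj (DG \<G> (field_strength A x) (fam_madj (field_strength A x)) x 0 (fam_madj B))"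
    by (rule DG_polarized[OF proto real subspace_lie])
       (simp_all add: fam_in_def field_strength_in B_def fam_upd_def assms subspace_0[OF subspace_lie])
  then have "trace (deriv_P \<G> A \<mu> \<nu> x ** X) = cnj (trace (deriv_Q \<G> A \<mu> \<nu> x ** madj X))"
    unfolding DG_P_eq_sum_trace[OF proto] DG_Q_eq_sum_trace[OF proto]
    using single[OF B0(1), of "\<lambda>\<mu> \<nu>. deriv_P \<G> A \<mu> \<nu> x"]
      single[OF B0(2), of "\<lambda>\<mu> \<nu>. deriv_Q \<G> A \<mu> \<nu> x"]
    by (simp only:) (simp add: B_def fam_upd_def fam_madj_def)
  then have "Re (trace (deriv_P \<G> A \<mu> \<nu> x ** X)) = Re (trace (deriv_Q \<G> A \<mu> \<nu> x ** madj X))"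
    by simp
  then show ?thesis
    by (simp add: inner_eq_Re_trace trace_mul_sym[of _ X] trace_mul_sym[of _ "madj X"])
qed

text \<open>On \<open>\<gg>\<close> the starred derivative and the adjoint of the unstarred one
  define the same real functional, so their projections agree.\<close>

lemma proj_Ghat_star:
  assumes "madj ` \<gg> = \<gg>"
  shows "proj \<gg> (Ghat_star \<G> A \<mu> \<nu> x) = madj (proj \<gg> (Ghat \<G> A \<mu> \<nu> x))"
proof -
  have inner: "X \<bullet> Ghat_star \<G> A \<mu> \<nu> x = madj X \<bullet> Ghat \<G> A \<mu> \<nu> x" if "X \<in> \<gg>" for X
    using inner_deriv_Q[OF that] by (auto simp: antisym_ext_def)
  show ?thesis
    unfolding proj_madj[OF subspace_lie assms, symmetric]
  proof (rule proj_eqI[OF subspace_lie proj_in[OF subspace_lie]])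
    fix X assume X: "X \<in> \<gg>"
    then show "X \<bullet> proj \<gg> (madj (Ghat \<G> A \<mu> \<nu> x)) = X \<bullet> Ghat_star \<G> A \<mu> \<nu> x"
      using inner[OF X] inner_madj[of "madj X" "Ghat \<G> A \<mu> \<nu> x"] by (simp add: inner_proj[OF subspace_lie])
  qed
qed

text \<open>Regularity is inherited from the starred derivative through the adjoint.\<close>

lemma C1_proj_Ghat:
  assumes "madj ` \<gg> = \<gg>"
  shows "C1 (\<lambda>x. proj \<gg> (Ghat \<G> A \<mu> \<nu> x))"
proof -
  have "proj \<gg> (Ghat \<G> A \<mu> \<nu> x) = madj (proj \<gg> (Ghat_star \<G> A \<mu> \<nu> x))" for x
    by (simp add: proj_Ghat_star[OF assms])
  then show ?thesis
    by (simp only:) (intro C1_bounded_linear[OF bounded_linear_madj]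
        C1_bounded_linear[OF bounded_linear_proj[OF subspace_lie]] C1_Ghat_star)
qed

text \<open>Each covariant derivative is now in \<open>\<gg>\<close> together with its adjoint, so
  the outer projection acts as the identity; injectivity of the adjoint removes the last
  \<open>madj\<close>.\<close>

lemma euler_lagrange_iff_self_adjoint:
  assumes "madj ` \<gg> = \<gg>"
  shows "euler_lagrange \<gg> \<G> A \<longleftrightarrow>
    (\<forall>\<kappa> x. (\<Sum>\<mu>\<in>UNIV. cov_deriv A \<mu> (\<lambda>y. proj \<gg> (Ghat \<G> A \<mu> \<kappa> y)) x) = 0)"
proof -
  have "proj \<gg> (madj (cov_deriv A \<mu> (\<lambda>y. madj (proj \<gg> (Ghat_star \<G> A \<mu> \<kappa> y))) x)) =
      madj (cov_deriv A \<mu> (\<lambda>y. proj \<gg> (Ghat \<G> A \<mu> \<kappa> y)) x)" for \<mu> \<kappa> x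
  proof -
    have "cov_deriv A \<mu> (\<lambda>y. proj \<gg> (Ghat \<G> A \<mu> \<kappa> y)) x \<in> \<gg>"
      using proj_in[OF subspace_lie] by (intro cov_deriv_in[where A = A, OF lie A_in C1_proj_Ghat[OF assms]]) auto
    then have "madj (cov_deriv A \<mu> (\<lambda>y. proj \<gg> (Ghat \<G> A \<mu> \<kappa> y)) x) \<in> \<gg>"
      using assms by blast
    then show ?thesis
      by (simp add: proj_Ghat_star[OF assms] proj_id[OF subspace_lie])
  qed
  then have "(\<Sum>\<mu>\<in>UNIV. proj \<gg> (madj (cov_deriv A \<mu> (\<lambda>y. madj (proj \<gg> (Ghat_star \<G> A \<mu> \<kappa> y))) x))) =
      madj (\<Sum>\<mu>\<in>UNIV. cov_deriv A \<mu> (\<lambda>y. proj \<gg> (Ghat \<G> A \<mu> \<kappa> y)) x)" for \<kappa> x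
    by (simp add: madj_simps)
  moreover have "madj Z = 0 \<longleftrightarrow> Z = 0" for Z :: "complex^'c^'c"
    by (metis madj_madj madj_simps(4))
  ultimately show ?thesis
    by (simp add: euler_lagrange_iff_star)
qed

end

section \<open>The algebras preserving a hermitian form\<close>

lemma madj_lie_J:
  assumes "J = madj J" "J ** J = mat 1"
  shows "madj ` lie_J J = lie_J J"
proof -
  have "madj X \<in> lie_J J" if "X \<in> lie_J J" for X
  proof -
    \<comment> \<open>Conjugating by J and using J ** J = 1 turns the defining equation of X into
      that of its adjoint.\<close>
    have "J ** (madj X ** J + J ** X) ** J = 0"
      using that by (simp add: lie_J_def)
    moreover have "J ** (madj X ** J + J ** X) ** J = J ** madj X ** (J ** J) + (J ** J) ** X ** J"
      by (simp add: matrix_mult_linear matrix_mul_assoc)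
    ultimately show ?thesis
      by (simp add: lie_J_def assms(2) add.commute)
  qed
  \<comment> \<open>One inclusion suffices because the adjoint is an involution.\<close>
  then show ?thesis
    by (metis (no_types, lifting) image_subset_iff madj_madj rev_image_eqI subsetI subset_antisym)
qed

text \<open>The map Z to -J Z^dagger J is a real linear isometric involution with fixed point set
  \<open>lie_J J\<close>; averaging it with the identity gives the orthogonal projection.\<close>

lemma Q_J_eq_proj:
  fixes J :: "complex^'c^'c"
  assumes J: "J = madj J" "J ** J = mat 1" and sub: "subspace (lie_J J)"
  shows "Q_J J Z = proj (lie_J J) Z"
proof (rule proj_eqI[OF sub, symmetric])
  have "madj (J ** madj Z ** J) ** J = J ** Z"
    using J by (metis madj_madj madj_mult matrix_mul_assoc matrix_mul_rid)
  moreover have "J ** (J ** madj Z ** J) = madj Z ** J"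
    using J by (metis matrix_mul_assoc matrix_mul_lid)
  ultimately show "Q_J J Z \<in> lie_J J"
    by (simp add: lie_J_def Q_J_def madj_simps matrix_mult_linear matrix_mult_scaleR)
  fix X assume "X \<in> lie_J J"
  then have "madj X ** J = - (J ** X)"
    by (simp add: lie_J_def eq_neg_iff_add_eq_0)
  then have "madj X ** (J ** madj Z ** J) = - (J ** X ** madj Z ** J)"
    by (simp add: matrix_mul_assoc matrix_mult_linear)
  moreover have "trace (J ** X ** madj Z ** J) = trace (X ** madj Z)"
    using J by (metis matrix_mul_assoc matrix_mul_lid trace_mul_sym)
  moreover have "trace (X ** madj Z) = cnj (trace (madj X ** Z))"
    by (metis madj_madj madj_mult trace_madj trace_mul_sym)
  moreover have "trace (- M) = - trace M" for M :: "complex^'c^'c"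
    by (simp add: trace_def sum_negf)
  ultimately have "X \<bullet> (J ** madj Z ** J) = - (X \<bullet> Z)"
    by (simp add: inner_eq_Re_trace)
  then show "X \<bullet> Q_J J Z = X \<bullet> Z"
    by (simp add: Q_J_def inner_diff_right)
qed

theorem theorem3p3:
  fixes \<gg> :: "(complex^'c::finite^'c) set"
    and \<G> :: "('c, 'n::{finite,linorder}) proto"
    and A :: "('c, 'n) gauge_field"
  assumes "matrix_lie_algebra \<gg>"
    and "gauge_proto_lagrangian \<gg> \<G>"
    and "polarized_reality \<gg> \<G>"
    and "is_gauge_field \<gg> A"
  shows
    "(euler_lagrange \<gg> \<G> A \<longleftrightarrow>
       (\<forall>\<kappa> x. (\<Sum>\<mu>\<in>UNIV. proj \<gg> (madj
          (cov_deriv A \<mu> (\<lambda>y. madj (proj \<gg> (Ghat_star \<G> A \<mu> \<kappa> y))) x))) = 0))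
     \<and>
     (madj ` \<gg> = \<gg> \<longrightarrow>
       (euler_lagrange \<gg> \<G> A \<longleftrightarrow>
        (\<forall>\<kappa> x. (\<Sum>\<mu>\<in>UNIV. cov_deriv A \<mu> (\<lambda>y. proj \<gg> (Ghat \<G> A \<mu> \<kappa> y)) x) = 0)))
     \<and>
     (\<forall>J. J = madj J \<and> J ** J = mat 1 \<and> \<gg> = lie_J J \<longrightarrow>
       madj ` \<gg> = \<gg> \<and>
       (euler_lagrange \<gg> \<G> A \<longleftrightarrow>
        (\<forall>\<kappa> x. (\<Sum>\<mu>\<in>UNIV. cov_deriv A \<mu> (\<lambda>y. Q_J J (Ghat \<G> A \<mu> \<kappa> y)) x) = 0)))"
proof (intro conjI impI allI)
  show "euler_lagrange \<gg> \<G> A \<longleftrightarrow>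
       (\<forall>\<kappa> x. (\<Sum>\<mu>\<in>UNIV. proj \<gg> (madj
          (cov_deriv A \<mu> (\<lambda>y. madj (proj \<gg> (Ghat_star \<G> A \<mu> \<kappa> y))) x))) = 0)"
    by (rule euler_lagrange_iff_star[OF assms])
  show B: "euler_lagrange \<gg> \<G> A \<longleftrightarrow>
        (\<forall>\<kappa> x. (\<Sum>\<mu>\<in>UNIV. cov_deriv A \<mu> (\<lambda>y. proj \<gg> (Ghat \<G> A \<mu> \<kappa> y)) x) = 0)"
    if "madj ` \<gg> = \<gg>"
    by (rule euler_lagrange_iff_self_adjoint[OF assms that])
  fix J assume J: "J = madj J \<and> J ** J = mat 1 \<and> \<gg> = lie_J J"
  then show sa: "madj ` \<gg> = \<gg>"
    using madj_lie_J by blast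
  \<comment> \<open>An equality of functions, so it rewrites under the abstraction inside
    \<open>cov_deriv\<close>.\<close>
  have "proj \<gg> = Q_J J"
    using J Q_J_eq_proj[of J] subspace_lie[OF assms] by auto
  with B[OF sa] show "euler_lagrange \<gg> \<G> A \<longleftrightarrow>
        (\<forall>\<kappa> x. (\<Sum>\<mu>\<in>UNIV. cov_deriv A \<mu> (\<lambda>y. Q_J J (Ghat \<G> A \<mu> \<kappa> y)) x) = 0)"
    by simp
qed

end
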